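(* Let $A$ be a unital $C^*$-algebra with $T(A)=\emptyset$. Then $U_0(M_n(A))=CU(M_n(A))$ for every integer $n\ge 1$.
   Context: $T(A)$ denotes the set of tracial states of $A$. For a unital $C^*$-algebra $B$, $U_0(B)$ is the connected component of the identity in the unitary group $U(B)$ (norm topology), and $CU(B)$ is the norm closure of the commutator subgroup of $U_0(B)$. $M_n(A)$ is the $C^*$-algebra of $n\times n$ matrices over $A$. *)

theory Defs
  imports "HOL-Analysis.Analysis" "HOL-Algebra.Generated_Groups"
begin

class star =
  fixes star :: "'a \<Rightarrow> 'a"

class scaleC =
  fixes scaleC :: "complex \<Rightarrow> 'a \<Rightarrow> 'a"

(* Unital complex C*-algebras. The library has real scalars only; scaleC_of_real
   makes its real structure the restriction of the complex one. Completeness and the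
   submultiplicative norm come from banach and real_normed_algebra_1. The latter also
   has 1 \<noteq> 0, so the algebras are nonzero. *)
class cstar_algebra = real_normed_algebra_1 + banach + star + scaleC +
  assumes scaleC_add_right: "scaleC c (x + y) = scaleC c x + scaleC c y"
    and scaleC_add_left: "scaleC (c + d) x = scaleC c x + scaleC d x"
    and scaleC_scaleC: "scaleC c (scaleC d x) = scaleC (c * d) x"
    and scaleC_of_real: "scaleC (complex_of_real r) x = scaleR r x"
    and mult_scaleC_left: "scaleC c x * y = scaleC c (x * y)"
    and mult_scaleC_right: "x * scaleC c y = scaleC c (x * y)"
    and norm_scaleC: "norm (scaleC c x) = cmod c * norm x"
    and star_star: "star (star x) = x"
    and star_add: "star (x + y) = star x + star y"
    and star_mult: "star (x * y) = star y * star x"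
    and star_scaleC: "star (scaleC c x) = scaleC (cnj c) (star x)"
    and norm_star_mult_self: "norm (star x * x) = (norm x)\<^sup>2"

definition tracial_states :: "('a::cstar_algebra \<Rightarrow> complex) set" where
  "tracial_states = {\<tau>.
     (\<forall>x y. \<tau> (x + y) = \<tau> x + \<tau> y) \<and>
     (\<forall>c x. \<tau> (scaleC c x) = c * \<tau> x) \<and>
     (\<forall>x. \<tau> (star x * x) \<in> \<real>\<^sub>\<ge>\<^sub>0) \<and>
     \<tau> 1 = 1 \<and>
     (\<forall>x y. \<tau> (x * y) = \<tau> (y * x))}"

(* The groups below need only the product, the involution and the topology, so they
   are stated for that much structure. *)

definition unitaries :: "'a::{monoid_mult, star} set" where
  "unitaries = {u. star u * u = 1 \<and> u * star u = 1}"

definition U0 :: "'a::{monoid_mult, star, topological_space} set" where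
  "U0 = connected_component_set unitaries 1"

definition U0_group :: "'a::{monoid_mult, star, topological_space} monoid" where
  "U0_group = \<lparr>carrier = U0, monoid.mult = (*), one = 1\<rparr>"

definition CU :: "'a::{monoid_mult, star, topological_space} set" where
  "CU = closure (derived U0_group U0)"

(* M_n(A) with n = CARD('n). A separate type is needed because the library equips
   'a^'n^'n with a different norm. *)
typedef ('a, 'n) cmat = "UNIV :: ('a^'n^'n) set"
  morphisms entries CMat ..

setup_lifting type_definition_cmat

instantiation cmat :: (ring_1, finite) ring
begin
lift_definition zero_cmat :: "('a, 'b) cmat" is "0" .
lift_definition plus_cmat :: "('a, 'b) cmat \<Rightarrow> ('a, 'b) cmat \<Rightarrow> ('a, 'b) cmat" is "(+)" .
lift_definition minus_cmat :: "('a, 'b) cmat \<Rightarrow> ('a, 'b) cmat \<Rightarrow> ('a, 'b) cmat" is "(-)" .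
lift_definition uminus_cmat :: "('a, 'b) cmat \<Rightarrow> ('a, 'b) cmat" is "uminus" .
lift_definition times_cmat :: "('a, 'b) cmat \<Rightarrow> ('a, 'b) cmat \<Rightarrow> ('a, 'b) cmat" is "(**)" .
instance
proof
  fix M N P :: "('a, 'b) cmat"
  show "M + N + P = M + (N + P)" by transfer (rule add.assoc)
  show "M + N = N + M" by transfer (rule add.commute)
  show "0 + M = M" by transfer (rule add_0_left)
  show "- M + M = 0" by transfer (rule left_minus)
  show "M - N = M + - N" by transfer (rule diff_conv_add_uminus)
  show "M * N * P = M * (N * P)" by transfer (rule matrix_mul_assoc[symmetric])
  show "(M + N) * P = M * P + N * P"
    by transfer (simp add: vec_eq_iff matrix_matrix_mult_def distrib_right sum.distrib)
  show "M * (N + P) = M * N + M * P"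
    by transfer (simp add: vec_eq_iff matrix_matrix_mult_def distrib_left sum.distrib)
qed
end

instantiation cmat :: (ring_1, finite) ring_1
begin
lift_definition one_cmat :: "('a, 'b) cmat" is "mat 1" .
instance
proof
  show "(0 :: ('a, 'b) cmat) \<noteq> 1"
    by transfer (auto simp: vec_eq_iff mat_def)
next
  fix M :: "('a, 'b) cmat"
  show "1 * M = M" by transfer (rule matrix_mul_lid)
  show "M * 1 = M" by transfer (rule matrix_mul_rid)
qed
end

instantiation cmat :: (real_vector, finite) scaleR
begin
lift_definition scaleR_cmat :: "real \<Rightarrow> ('a, 'b) cmat \<Rightarrow> ('a, 'b) cmat" is "scaleR" .
instance ..
end

instantiation cmat :: (scaleC, finite) scaleC
begin
lift_definition scaleC_cmat :: "complex \<Rightarrow> ('a, 'b) cmat \<Rightarrow> ('a, 'b) cmat"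
  is "\<lambda>c M. \<chi> i j. scaleC c (M $ i $ j)" .
instance ..
end

instantiation cmat :: (star, finite) star
begin
lift_definition star_cmat :: "('a, 'b) cmat \<Rightarrow> ('a, 'b) cmat"
  is "\<lambda>M. \<chi> i j. star (M $ j $ i)" .
instance ..
end

(* The norm of the Hilbert A-module A^n, whose inner product is
   \<langle>v, w\<rangle> = \<Sum>i. v_i^* w_i. *)
definition module_norm :: "'a::cstar_algebra^'n \<Rightarrow> real" where
  "module_norm v = sqrt (norm (\<Sum>i\<in>UNIV. star (v $ i) * v $ i))"

(* The C*-norm of M_n(A): the operator norm for the action on A^n. *)
definition cmat_norm :: "('a::cstar_algebra, 'n::finite) cmat \<Rightarrow> real" where
  "cmat_norm M = (SUP v\<in>{v. module_norm v \<le> 1}. module_norm (entries M *v v))"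

instantiation cmat :: (cstar_algebra, finite) topological_space
begin
definition open_cmat_def:
  "open (S :: ('a, 'b) cmat set) \<longleftrightarrow> (\<forall>M\<in>S. \<exists>e>0. \<forall>N. cmat_norm (N - M) < e \<longrightarrow> N \<in> S)"
instance
proof
  fix S T :: "('a, 'b) cmat set"
  assume S: "open S" and T: "open T"
  show "open (S \<inter> T)"
    unfolding open_cmat_def
  proof
    fix M assume "M \<in> S \<inter> T"
    then obtain d e where "d > 0" "\<forall>N. cmat_norm (N - M) < d \<longrightarrow> N \<in> S"
        "e > 0" "\<forall>N. cmat_norm (N - M) < e \<longrightarrow> N \<in> T"
      using S T unfolding open_cmat_def by blast
    then show "\<exists>e>0. \<forall>N. cmat_norm (N - M) < e \<longrightarrow> N \<in> S \<inter> T"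
      by (intro exI[of _ "min d e"]) auto
  qed
next
  show "open (UNIV :: ('a, 'b) cmat set)"
    unfolding open_cmat_def by (auto intro: exI[of _ 1])
next
  fix K :: "('a, 'b) cmat set set"
  assume K: "\<forall>S\<in>K. open S"
  show "open (\<Union>K)"
    unfolding open_cmat_def
  proof
    fix M assume "M \<in> \<Union>K"
    then obtain S where "S \<in> K" "M \<in> S" by blast
    then obtain e where "e > 0" "\<forall>N. cmat_norm (N - M) < e \<longrightarrow> N \<in> S"
      using K unfolding open_cmat_def by blast
    with \<open>S \<in> K\<close> show "\<exists>e>0. \<forall>N. cmat_norm (N - M) < e \<longrightarrow> N \<in> \<Union>K"
      by blast
  qed
qed
end

end

theory Submission
  imports Defs
begin

text \<open>\<open>M_n(A)\<close> is a C*-algebra without tracial states, so it suffices to treat a C*-algebra \<open>A\<close>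
  itself. If no tracial state exists, a separation argument yields \<open>- 1 = q + \<Sum>(x_i^* x_i - x_i x_i^*)\<close>
  with \<open>q\<close> positive. Pop's trick turns this into a map that contracts selfadjoint elements and
  changes them only by commutators; so the closed span of the \<open>x^* x - x x^*\<close> contains every
  selfadjoint element. On the group side, the \<open>x\<close> with \<open>exp (t x) \<in> CU\<close> for all \<open>t\<close> form a closed
  real Lie algebra containing all commutators of skew elements, by the Trotter product formulas.
  Hence \<open>CU\<close> contains all exponentials of skew elements, and these generate \<open>U0\<close>.\<close>

subsection \<open>Elementary properties of the involution\<close>

text \<open>Positivity is treated without spectra. The only tool is a square root of
  \<open>1 - w\<close> for \<open>norm w < 1\<close>, so roots exist only after adding some
  \<open>e > 0\<close>, and facts about positive elements follow by letting \<open>e\<close> tend to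
  \<open>0\<close>. The hard point is that \<open>star x * x\<close> is positive; both the inner
  product behind the norm of \<open>M_n(A)\<close> and the positivity of the trace depend on it. The
  separation is purely algebraic: \<open>1\<close> is an order unit, so a cone avoiding
  \<open>- 1\<close> already yields a functional. Hence \<open>- 1\<close> lies in the cone itself
  and not merely in its closure. The resulting identity says that the sum of the
  \<open>x * star x\<close> exceeds that of the \<open>star x * x\<close> by at least
  \<open>1\<close>, and this surplus is what makes Pop's map contract. The two sides of the proof
  meet because the commutator of \<open>y + star y\<close> with \<open>y - star y\<close> is twice
  \<open>star y * y - y * star y\<close>: after multiplication by \<open>\<i>\<close> it is a
  commutator of skew elements, the kind that group commutators produce.\<close>

lemma scaleC_zero_right [simp]: "scaleC c (0::'a::cstar_algebra) = 0"
  using scaleC_add_right[of c 0 "0::'a"] by simp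

lemma scaleC_minus_right [simp]: "scaleC c (- x) = - scaleC c (x::'a::cstar_algebra)"
  using scaleC_add_right[of c x "- x"] by (simp add: eq_neg_iff_add_eq_0 add.commute)

lemma scaleC_diff_right: "scaleC c (x - y) = scaleC c x - scaleC c (y::'a::cstar_algebra)"
  using scaleC_add_right[of c x "- y"] by simp

lemma scaleC_one [simp]: "scaleC 1 x = (x::'a::cstar_algebra)"
  using scaleC_of_real[of 1 x] by simp

lemma scaleC_zero_left [simp]: "scaleC 0 x = (0::'a::cstar_algebra)"
  using scaleC_of_real[of 0 x] by simp

lemma scaleC_minus_left [simp]: "scaleC (- c) x = - scaleC c (x::'a::cstar_algebra)"
  using scaleC_add_left[of c "- c" x] by (simp add: eq_neg_iff_add_eq_0 add.commute)

lemma scaleC_i_i [simp]: "scaleC \<i> (scaleC \<i> x) = - (x::'a::cstar_algebra)"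
  by (simp add: scaleC_scaleC)

lemma scaleC_sum: "scaleC c (\<Sum>i\<in>I. f i) = (\<Sum>i\<in>I. scaleC c (f i :: 'a::cstar_algebra))"
  by (induction I rule: infinite_finite_induct) (simp_all add: scaleC_add_right)

lemma scaleC_scaleR: "scaleC c (r *\<^sub>R x) = r *\<^sub>R scaleC c (x::'a::cstar_algebra)"
  by (simp add: scaleC_scaleC mult.commute flip: scaleC_of_real)

lemma scaleC_complex: "scaleC c x = Re c *\<^sub>R x + Im c *\<^sub>R scaleC \<i> (x::'a::cstar_algebra)"
proof -
  have "c = complex_of_real (Re c) + complex_of_real (Im c) * \<i>"
    by (simp add: complex_eq_iff)
  then have "scaleC c x = scaleC (complex_of_real (Re c) + complex_of_real (Im c) * \<i>) x"
    by simp
  then show ?thesis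
    by (simp add: scaleC_add_left scaleC_of_real flip: scaleC_scaleC)
qed

lemma star_scaleR [simp]: "star (r *\<^sub>R x) = r *\<^sub>R star (x::'a::cstar_algebra)"
  using star_scaleC[of "complex_of_real r" x] by (simp add: scaleC_of_real)

lemma star_zero [simp]: "star 0 = (0::'a::cstar_algebra)"
  using star_scaleR[of 0 "0::'a"] by simp

lemma star_minus [simp]: "star (- x) = - star (x::'a::cstar_algebra)"
  using star_scaleR[of "- 1" x] by simp

lemma star_diff: "star (x - y) = star x - star (y::'a::cstar_algebra)"
  using star_add[of x "- y"] by simp

lemma star_one [simp]: "star 1 = (1::'a::cstar_algebra)"
  by (metis mult.left_neutral mult.right_neutral star_mult star_star)

lemma star_of_real [simp]: "star (of_real r) = (of_real r::'a::cstar_algebra)"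
  by (simp add: of_real_def)

declare star_star [simp]

lemma norm_star [simp]: "norm (star x) = norm (x::'a::cstar_algebra)"
proof -
  have le: "norm x \<le> norm (star x)" for x :: 'a
  proof (cases "x = 0")
    case False
    have "norm x * norm x \<le> norm (star x) * norm x"
      by (metis norm_star_mult_self norm_mult_ineq power2_eq_square)
    with False show ?thesis by simp
  qed simp
  from le[of x] le[of "star x"] show ?thesis by simp
qed

lemma bounded_linear_star: "bounded_linear (star :: 'a::cstar_algebra \<Rightarrow> 'a)"
  by (rule bounded_linear_intro[where K = 1]) (simp_all add: star_add)

lemma continuous_on_star [continuous_intros]:
  "continuous_on S f \<Longrightarrow> continuous_on S (\<lambda>x. star (f x :: 'a::cstar_algebra))"
  by (rule bounded_linear.continuous_on[OF bounded_linear_star])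

lemma norm_mult_star_self: "norm (x * star x) = (norm (x::'a::cstar_algebra))\<^sup>2"
  using norm_star_mult_self[of "star x"] by simp

lemma norm_selfadjoint_square:
  "star a = a \<Longrightarrow> norm (a * a) = (norm (a::'a::cstar_algebra))\<^sup>2"
  using norm_star_mult_self[of a] by simp

lemma star_power: "star (x ^ n) = star (x::'a::cstar_algebra) ^ n"
  by (induction n) (simp_all add: star_mult power_commutes)

lemma star_sum: "star (\<Sum>i\<in>I. f i) = (\<Sum>i\<in>I. star (f i :: 'a::cstar_algebra))"
  by (induction I rule: infinite_finite_induct) (simp_all add: star_add)

text \<open>Repeated squaring with the C*-identity settles the exponents \<open>2 ^ n\<close>. For
  general \<open>k\<close>, factor \<open>a ^ (2 ^ k)\<close> through \<open>a ^ k\<close> and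
  cancel the remaining power of \<open>norm a\<close>.\<close>

lemma norm_selfadjoint_power:
  assumes "star a = (a::'a::cstar_algebra)"
  shows "norm (a ^ k) = norm a ^ k"
proof (cases "a = 0")
  case False
  have two: "norm (a ^ (2 ^ n)) = norm a ^ (2 ^ n)" for n
  proof (induction n)
    case (Suc n)
    have "a ^ (2 ^ Suc n) = a ^ (2 ^ n) * a ^ (2 ^ n)"
      by (simp add: mult_2 power_add)
    then have "norm (a ^ (2 ^ Suc n)) = norm (a ^ (2 ^ n) * a ^ (2 ^ n))"
      by simp
    also have "\<dots> = (norm (a ^ (2 ^ n)))\<^sup>2"
      using assms by (intro norm_selfadjoint_square) (simp add: star_power)
    finally show ?case
      using Suc by (simp add: power2_eq_square mult_2 power_add)
  qed simp
  define m where "m = (2::nat) ^ k"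
  have "k \<le> m" by (simp add: m_def less_imp_le)
  then have "norm a ^ k * norm a ^ (m - k) = norm (a ^ m)"
    using two[of k] by (simp add: m_def flip: power_add)
  also have "a ^ m = a ^ k * a ^ (m - k)"
    using \<open>k \<le> m\<close> by (simp flip: power_add)
  also have "norm \<dots> \<le> norm (a ^ k) * norm a ^ (m - k)"
    by (meson norm_mult_ineq norm_power_ineq mult_left_mono norm_ge_zero order_trans)
  finally have "norm a ^ k \<le> norm (a ^ k)"
    using False by simp
  then show ?thesis
    using norm_power_ineq[of a k] by simp
qed (simp add: power_0_left)

subsection \<open>Positive elements\<close>

text \<open>With \<open>k = 1 - v\<close>, the equation \<open>k * k = 1 - w\<close> becomes the
  fixed point equation \<open>v = (1/2) *\<^sub>R (w + v * v)\<close>. The commutation clause stands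
  in for functional calculus: it lets roots of commuting elements commute.\<close>

lemma sqrt_one_minus:
  fixes w :: "'a::cstar_algebra"
  assumes "star w = w" "norm w < 1"
  obtains k where "star k = k" "k * k = 1 - w" "\<And>y. y * w = w * y \<Longrightarrow> y * k = k * y"
proof -
  \<comment> \<open>\<open>\<theta>\<close> is the smaller root of
    \<open>(norm w + t * t) / 2 = t\<close>: the ball of radius \<open>\<theta>\<close> is mapped
    into itself, and \<open>\<theta> < 1\<close> is also the contraction constant.\<close>
  define \<theta> where "\<theta> = 1 - sqrt (1 - norm w)"
  have \<theta>: "0 \<le> \<theta>" "\<theta> < 1" "(norm w + \<theta> * \<theta>) / 2 = \<theta>"
  proof -
    have "(sqrt (1 - norm w))\<^sup>2 = 1 - norm w"
      using assms by (intro real_sqrt_pow2) simp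
    then show "(norm w + \<theta> * \<theta>) / 2 = \<theta>"
      unfolding \<theta>_def by (simp add: field_simps power2_eq_square)
  qed (use assms in \<open>auto simp: \<theta>_def\<close>)
  \<comment> \<open>Selfadjointness and commutation are closed conditions preserved by
    \<open>g\<close>, so they are built into the domain and pass to the fixed point.\<close>
  define S where "S = {v. norm v \<le> \<theta> \<and> star v = v \<and> (\<forall>y. y * w = w * y \<longrightarrow> y * v = v * y)}"
  define g where "g v = (1/2) *\<^sub>R (w + v * v)" for v
  have "S = {v. norm v \<le> \<theta>} \<inter> {v. star v = v} \<inter> (\<Inter>y\<in>{y. y * w = w * y}. {v. y * v = v * y})"
    by (auto simp: S_def)
  moreover have "closed \<dots>"
    by (intro closed_Int closed_INT ballI closed_Collect_le closed_Collect_eq continuous_intros)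
  ultimately have "complete S" by (simp add: complete_eq_closed)
  moreover have "0 \<in> S" using \<theta> by (simp add: S_def)
  moreover have "g ` S \<subseteq> S"
  proof (intro image_subsetI)
    fix v assume v: "v \<in> S"
    then have sv: "star v = v" by (simp add: S_def)
    have "norm (v * v) \<le> \<theta> * \<theta>"
      using v \<theta> by (intro order_trans[OF norm_mult_ineq] mult_mono) (auto simp: S_def)
    then have "norm (w + v * v) \<le> norm w + \<theta> * \<theta>"
      by (intro order_trans[OF norm_triangle_ineq]) simp
    then have "norm (g v) \<le> \<theta>" using \<theta> by (simp add: g_def)
    moreover have "star (g v) = g v"
      by (simp add: g_def star_add star_mult sv assms(1))
    moreover have "y * g v = g v * y" if "y * w = w * y" for y
    proof -
      have "y * v = v * y" using v that by (auto simp: S_def)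
      then have "y * (v * v) = (v * v) * y" by (metis mult.assoc)
      with that show ?thesis by (simp add: g_def algebra_simps)
    qed
    ultimately show "g v \<in> S" by (simp add: S_def)
  qed
  moreover have "dist (g v) (g v') \<le> \<theta> * dist v v'" if "v \<in> S" "v' \<in> S" for v v'
  proof -
    have "g v - g v' = (1/2) *\<^sub>R (v * (v - v') + (v - v') * v')"
      by (simp add: g_def algebra_simps)
    also have "norm \<dots> \<le> (1/2) * (norm v * norm (v - v') + norm (v - v') * norm v')"
      by (simp, meson add_mono norm_mult_ineq norm_triangle_ineq order_trans)
    also have "\<dots> \<le> (1/2) * (\<theta> * norm (v - v') + norm (v - v') * \<theta>)"
      using that by (intro mult_left_mono add_mono mult_right_mono) (auto simp: S_def)
    finally show ?thesis by (simp add: dist_norm mult.commute)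
  qed
  ultimately obtain v where v: "v \<in> S" "g v = v"
    using Banach_fix[of S \<theta> g] \<theta> by blast
  have "2 *\<^sub>R v = 2 *\<^sub>R g v" using v by simp
  then have "v + v = w + v * v" by (simp add: g_def scaleR_2)
  then have "(1 - v) * (1 - v) = 1 - w" by (simp add: algebra_simps)
  moreover have "star (1 - v) = 1 - v" using v by (simp add: S_def star_diff)
  moreover have "y * (1 - v) = (1 - v) * y" if "y * w = w * y" for y
  proof -
    have "y * v = v * y" using v(1) that by (simp add: S_def)
    then show ?thesis by (simp add: algebra_simps)
  qed
  ultimately show thesis using that by blast
qed

text \<open>\<open>z\<close> and \<open>k\<close> are the real and imaginary parts of
  \<open>u = z + scaleC \<i> k\<close>, and the hypotheses make \<open>star u * u\<close> the scalar
  \<open>r^2\<close>. Hence \<open>norm u = r\<close>, and a real part never exceeds the element in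
  norm.\<close>

lemma norm_le_of_square_sum:
  fixes z k :: "'a::cstar_algebra"
  assumes "star z = z" "star k = k" "z * k = k * z" "z * z + k * k = of_real (r\<^sup>2)" "0 \<le> r"
  shows "norm z \<le> r"
proof -
  define u where "u = z + scaleC \<i> k"
  have su: "star u = z - scaleC \<i> k"
    using assms by (simp add: u_def star_add star_scaleC)
  have "star u * u = of_real (r\<^sup>2)"
    unfolding su unfolding u_def assms(4)[symmetric]
    by (simp add: algebra_simps mult_scaleC_left mult_scaleC_right scaleC_diff_right
        scaleC_add_right assms(3))
  then have "(norm u)\<^sup>2 = norm (of_real (r\<^sup>2) :: 'a)"
    by (simp only: norm_star_mult_self[symmetric])
  then have "(norm u)\<^sup>2 = r\<^sup>2"
    by (simp only: norm_of_real abs_power2)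
  then have "norm u = r" using assms(5) by (simp add: power2_eq_iff_nonneg)
  moreover have "z = (1/2) *\<^sub>R (u + star u)"
    unfolding su unfolding u_def by (simp flip: scaleR_2)
  moreover have "norm ((1/2) *\<^sub>R (u + star u)) \<le> norm u"
    using norm_triangle_ineq[of u "star u"] by simp
  ultimately show ?thesis by metis
qed

text \<open>Kadison's description of the positive cone, which makes closure under sums evident.\<close>

definition pos :: "'a::cstar_algebra set" where
  "pos = {a. star a = a \<and> norm (of_real (norm a) - a) \<le> norm a}"

lemma pos_selfadjoint: "a \<in> pos \<Longrightarrow> star a = a"
  by (simp add: pos_def)

lemma closed_pos: "closed (pos :: 'a::cstar_algebra set)"
proof -
  have "pos = {a::'a. star a = a} \<inter> {a. norm (of_real (norm a) - a) \<le> norm a}"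
    by (auto simp: pos_def)
  moreover have "closed \<dots>"
    by (intro closed_Int closed_Collect_eq closed_Collect_le continuous_intros)
  ultimately show ?thesis by simp
qed

text \<open>\<open>1 - h * h\<close> has a root \<open>k\<close> commuting with \<open>h\<close>;
  since \<open>k * k + h * h = 1\<close>, the previous bound applies to \<open>k\<close>.\<close>

lemma norm_one_minus_square:
  fixes h :: "'a::cstar_algebra"
  assumes "star h = h" "norm h < 1"
  shows "norm (1 - h * h) \<le> 1"
proof -
  have "norm (h * h) < 1"
    using assms by (simp add: norm_selfadjoint_square power_less_one_iff)
  moreover have "star (h * h) = h * h" using assms by (simp add: star_mult)
  ultimately obtain k where k: "star k = k" "k * k = 1 - h * h"
      "\<And>y. y * (h * h) = (h * h) * y \<Longrightarrow> y * k = k * y"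
    using sqrt_one_minus by blast
  have "h * k = k * h" by (rule k(3)) (simp add: mult.assoc)
  moreover have "k * k + h * h = of_real (1\<^sup>2)" by (simp add: k(2))
  ultimately have "norm k \<le> 1"
    using k(1) assms(1) by (intro norm_le_of_square_sum[where k = h]) simp_all
  then have "norm (k * k) \<le> 1"
    by (simp add: norm_selfadjoint_square[OF k(1)] power_le_one)
  then show ?thesis by (simp add: k(2))
qed

lemma norm_of_real_minus_square:
  fixes h :: "'a::cstar_algebra"
  assumes "star h = h" "norm (h * h) < t"
  shows "norm (of_real t - h * h) \<le> t"
proof -
  have t: "t > 0" using assms(2) norm_ge_zero[of "h * h"] by linarith
  define g where "g = (1 / sqrt t) *\<^sub>R h"
  have "(norm h)\<^sup>2 < t" using assms by (simp add: norm_selfadjoint_square)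
  then have "norm h < sqrt t" by (simp add: real_less_rsqrt)
  then have "norm g < 1" using t by (simp add: g_def divide_simps)
  then have "norm (1 - g * g) \<le> 1"
    using assms by (intro norm_one_minus_square) (auto simp: g_def)
  moreover have "of_real t - h * h = t *\<^sub>R (1 - g * g)"
    using t by (simp add: g_def scaleR_diff_right of_real_def)
  ultimately show ?thesis using t by (simp add: mult_left_le)
qed

text \<open>\<open>norm_of_real_minus_square\<close> needs a strict inequality, so the threshold
  \<open>norm (h * h)\<close> is approached from the right.\<close>

lemma square_in_pos:
  fixes h :: "'a::cstar_algebra"
  assumes "star h = h"
  shows "h * h \<in> pos"
proof -
  have "norm (of_real (norm (h * h)) - h * h) \<le> norm (h * h)"
  proof (rule tendsto_le[OF _ _ _ eventually_at_right_less[THEN eventually_mono]])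
    show "((\<lambda>t. norm (of_real t - h * h)) \<longlongrightarrow> norm (of_real (norm (h * h)) - h * h))
        (at_right (norm (h * h)))"
      by (intro tendsto_intros)
    show "((\<lambda>t. t) \<longlongrightarrow> norm (h * h)) (at_right (norm (h * h)))"
      by (intro tendsto_intros)
  qed (use assms norm_of_real_minus_square in auto)
  then show ?thesis using assms by (simp add: pos_def star_mult)
qed

text \<open>Since \<open>a + of_real e = (t + e) *\<^sub>R (1 - w)\<close> with
  \<open>norm w \<le> t / (t + e) < 1\<close>, the shift by \<open>e\<close> brings the element into
  the range of \<open>sqrt_one_minus\<close>.\<close>

lemma pos_plus_eps_square:
  fixes a :: "'a::cstar_algebra"
  assumes "star a = a" "norm (of_real t - a) \<le> t" "0 < e"
  obtains h where "star h = h" "h * h = a + of_real e" "\<And>y. y * a = a * y \<Longrightarrow> y * h = h * y"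
proof -
  have t: "0 \<le> t" using assms(2) norm_ge_zero order_trans by blast
  define w where "w = (1 / (t + e)) *\<^sub>R (of_real t - a)"
  have "norm w < 1" using assms t by (simp add: w_def divide_simps)
  moreover have "star w = w" using assms by (simp add: w_def star_diff)
  ultimately obtain k where k: "star k = k" "k * k = 1 - w" "\<And>y. y * w = w * y \<Longrightarrow> y * k = k * y"
    using sqrt_one_minus by blast
  define h where "h = sqrt (t + e) *\<^sub>R k"
  have "star h = h" using k(1) by (simp add: h_def)
  moreover have "h * h = a + of_real e"
  proof -
    have "h * h = (t + e) *\<^sub>R (k * k)" using assms t by (simp add: h_def)
    also have "\<dots> = (t + e) *\<^sub>R 1 - (of_real t - a)"
      using assms t by (simp add: k(2) w_def scaleR_diff_right)
    finally show ?thesis by (simp add: of_real_def scaleR_add_left)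
  qed
  moreover have "y * h = h * y" if "y * a = a * y" for y
  proof -
    have "y * w = w * y"
      using that by (simp add: w_def algebra_simps of_real_def)
    then have "y * k = k * y" by (rule k(3))
    then show ?thesis by (simp add: h_def)
  qed
  ultimately show thesis using that by blast
qed

text \<open>Kadison's condition may be checked at any bound \<open>t\<close>, not only at
  \<open>norm a\<close>: each \<open>a + of_real e\<close> is a square, and the cone is closed. This
  freedom reduces closure under sums to the triangle inequality.\<close>

lemma posI:
  fixes a :: "'a::cstar_algebra"
  assumes "star a = a" "norm (of_real t - a) \<le> t"
  shows "a \<in> pos"
proof -
  have "a + of_real e \<in> pos" if "e > 0" for e
    using pos_plus_eps_square[OF assms that] square_in_pos by metis
  then have "\<forall>\<^sub>F e in at_right (0::real). a + of_real e \<in> pos"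
    by (simp add: eventually_at_filter)
  moreover have "((\<lambda>e. a + of_real e) \<longlongrightarrow> a + of_real 0) (at_right (0::real))"
    by (intro tendsto_intros)
  ultimately show ?thesis
    using Lim_in_closed_set[OF closed_pos, of "\<lambda>e. a + of_real e" "at_right (0::real)" "a + of_real 0"] by simp
qed

lemma pos_eps_square:
  fixes a :: "'a::cstar_algebra"
  assumes "a \<in> pos" "0 < e"
  obtains h where "star h = h" "h * h = a + of_real e" "\<And>y. y * a = a * y \<Longrightarrow> y * h = h * y"
  using assms pos_plus_eps_square[of a "norm a" e, OF _ _ assms(2) that]
  unfolding pos_def by blast

lemma pos_add: "a \<in> pos \<Longrightarrow> b \<in> pos \<Longrightarrow> a + b \<in> (pos :: 'a::cstar_algebra set)"
proof -
  assume ab: "a \<in> pos" "b \<in> pos"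
  have "norm ((of_real (norm a) - a) + (of_real (norm b) - b)) \<le> norm a + norm b"
    using ab by (intro order_trans[OF norm_triangle_ineq] add_mono) (auto simp: pos_def)
  then show ?thesis
    using ab by (intro posI[where t = "norm a + norm b"]) (auto simp: pos_def star_add algebra_simps)
qed

lemma pos_scaleR: "a \<in> pos \<Longrightarrow> 0 \<le> r \<Longrightarrow> r *\<^sub>R a \<in> (pos :: 'a::cstar_algebra set)"
proof -
  assume a: "a \<in> pos" and r: "0 \<le> r"
  have "of_real (r * norm a) - r *\<^sub>R a = r *\<^sub>R (of_real (norm a) - a)"
    by (simp add: of_real_def scaleR_diff_right)
  then have "norm (of_real (r * norm a) - r *\<^sub>R a) \<le> r * norm a"
    using a r by (simp add: pos_def mult_left_mono)
  then show ?thesis using a by (intro posI[where t = "r * norm a"]) (auto simp: pos_def)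
qed

lemma of_real_minus_in_pos:
  "star a = a \<Longrightarrow> norm a \<le> r \<Longrightarrow> of_real r - a \<in> (pos :: 'a::cstar_algebra set)"
  by (rule posI[where t = r]) (auto simp: star_diff)

lemma of_real_in_pos: "0 \<le> r \<Longrightarrow> of_real r \<in> (pos :: 'a::cstar_algebra set)"
  using of_real_minus_in_pos[of 0 r] by simp

lemma zero_in_pos: "0 \<in> (pos :: 'a::cstar_algebra set)"
  using of_real_in_pos[of 0] by simp

lemma pos_sum: "(\<And>i. i \<in> I \<Longrightarrow> f i \<in> pos) \<Longrightarrow> (\<Sum>i\<in>I. f i) \<in> (pos :: 'a::cstar_algebra set)"
  by (induction I rule: infinite_finite_induct) (auto simp: zero_in_pos pos_add)

section \<open>Products, order and norm in the positive cone\<close>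

lemma pos_eps_limit:
  fixes a :: "'a::cstar_algebra"
  assumes "\<And>e. 0 < e \<Longrightarrow> e < 1 \<Longrightarrow> F e \<in> pos" "(F \<longlongrightarrow> a) (at_right (0::real))"
  shows "a \<in> pos"
proof (rule Lim_in_closed_set[OF closed_pos])
  show "\<forall>\<^sub>F e in at_right 0. F e \<in> pos"
    using eventually_at_right_less[of "0::real"] eventually_at_right_field[of "\<lambda>e. F e \<in> pos" 0] assms(1)
    by (meson zero_less_one)
qed (use assms in auto)

text \<open>Roots of the shifted elements commute because the elements do, so their product is
  selfadjoint and squares to the shifted product.\<close>

lemma pos_mult_commute:
  fixes a b :: "'a::cstar_algebra"
  assumes "a \<in> pos" "b \<in> pos" "a * b = b * a"
  shows "a * b \<in> pos"
proof (rule pos_eps_limit)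
  show "(a + of_real e) * (b + of_real e) \<in> pos" if e: "0 < e" for e :: real
  proof -
    obtain h where h: "star h = h" "h * h = a + of_real e" "\<And>y. y * a = a * y \<Longrightarrow> y * h = h * y"
      using pos_eps_square[OF assms(1) e] by blast
    obtain k where k: "star k = k" "k * k = b + of_real e" "\<And>y. y * b = b * y \<Longrightarrow> y * k = k * y"
      using pos_eps_square[OF assms(2) e] by blast
    have "b * h = h * b" by (rule h(3)) (simp add: assms(3))
    then have hk: "h * k = k * h" by (intro k(3)) simp
    have "(h * k) * (h * k) = (a + of_real e) * (b + of_real e)"
      unfolding h(2)[symmetric] k(2)[symmetric] by (metis hk mult.assoc)
    then show ?thesis
      using square_in_pos[of "h * k"] h(1) k(1) hk by (simp add: star_mult)
  qed
  have "((\<lambda>e. (a + of_real e) * (b + of_real e)) \<longlongrightarrow> (a + of_real 0) * (b + of_real 0)) (at_right (0::real))"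
    by (intro tendsto_intros)
  then show "((\<lambda>e. (a + of_real e) * (b + of_real e)) \<longlongrightarrow> a * b) (at_right (0::real))"
    by simp
qed

lemma pos_power: "c \<in> pos \<Longrightarrow> c ^ n \<in> (pos :: 'a::cstar_algebra set)"
  by (induction n) (use of_real_in_pos[of 1] in \<open>auto intro!: pos_mult_commute simp: power_commutes\<close>)

text \<open>Commuting roots \<open>h\<close> of \<open>r + e - z\<close> and \<open>k\<close> of
  \<open>r + e + z\<close> give \<open>(h * k) * (h * k) = (r + e)^2 - z * z\<close>, which is the
  hypothesis of \<open>norm_le_of_square_sum\<close>.\<close>

lemma norm_le_of_pos:
  fixes z :: "'a::cstar_algebra"
  assumes "star z = z" "0 \<le> r" "of_real r - z \<in> pos" "of_real r + z \<in> pos"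
  shows "norm z \<le> r"
proof (rule field_le_epsilon)
  fix e :: real assume e: "0 < e"
  obtain h where h: "star h = h" "h * h = of_real r - z + of_real e"
      "\<And>y. y * (of_real r - z) = (of_real r - z) * y \<Longrightarrow> y * h = h * y"
    using pos_eps_square[OF assms(3) e] by blast
  obtain k where k: "star k = k" "k * k = of_real r + z + of_real e"
      "\<And>y. y * (of_real r + z) = (of_real r + z) * y \<Longrightarrow> y * k = k * y"
    using pos_eps_square[OF assms(4) e] by blast
  have zh: "z * h = h * z" and zk: "z * k = k * z"
    by (auto intro!: h(3) k(3) simp: algebra_simps of_real_def)
  have "h * k = k * h" using zh by (intro k(3)) (simp add: algebra_simps of_real_def)
  then have hk: "(h * k) * (h * k) = (h * h) * (k * k)" by (metis mult.assoc)
  show "norm z \<le> r + e"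
  proof (rule norm_le_of_square_sum[where k = "h * k"])
    show "z * (h * k) = h * k * z" using zh zk by (metis mult.assoc)
    show "star (h * k) = h * k" using h(1) k(1) \<open>h * k = k * h\<close> by (simp add: star_mult)
    show "z * z + h * k * (h * k) = of_real ((r + e)\<^sup>2)"
      unfolding hk h(2) k(2)
      by (simp add: algebra_simps power2_eq_square of_real_def)
        (simp add: algebra_simps flip: scaleR_add_left)
  qed (use assms e in auto)
qed

lemma norm_mono_pos:
  fixes a b :: "'a::cstar_algebra"
  assumes "a \<in> pos" "b - a \<in> pos"
  shows "norm a \<le> norm b"
proof (rule norm_le_of_pos)
  have sb: "star b = b"
    using assms pos_selfadjoint[of a] pos_selfadjoint[of "b - a"] by (simp add: star_diff)
  show "star a = a" by (rule pos_selfadjoint[OF assms(1)])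
  show "of_real (norm b) + a \<in> pos" by (intro pos_add of_real_in_pos assms) simp
  have "(of_real (norm b) - b) + (b - a) \<in> pos"
    using sb by (intro pos_add of_real_minus_in_pos assms) auto
  then show "of_real (norm b) - a \<in> pos" by simp
qed simp

text \<open>With \<open>c = 1 - star x * x\<close> and \<open>y = x * c ^ m\<close>, the elements \<open>star y * y\<close> and \<open>y * star y\<close> are
  at most \<open>1\<close> and their sum is positive; hence \<open>star y * y = (1 - c) * c ^ (2 * m)\<close> has norm at
  most \<open>1\<close> for all \<open>m\<close>, which forces \<open>norm c \<le> 1\<close>.\<close>

lemma star_mult_self_in_pos_aux:
  fixes x :: "'a::cstar_algebra"
  assumes x: "norm x \<le> 1"
  shows "star x * x \<in> pos"
proof -
  define a b where "a = star x * x" and "b = x * star x"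
  define c d where "c = 1 - a" and "d = 1 - b"
  have sa: "star a = a" "star b = b" by (simp_all add: a_def b_def star_mult)
  have na: "norm a \<le> 1" "norm b \<le> 1"
    using x norm_star_mult_self[of x] norm_mult_star_self[of x]
    by (auto simp: a_def b_def power_le_one)
  have c: "c \<in> pos" and d: "d \<in> pos"
    using of_real_minus_in_pos[of a 1] of_real_minus_in_pos[of b 1] sa na
    by (simp_all add: c_def d_def)
  \<comment> \<open>With \<open>s\<close> the sum of \<open>e ^ i\<close> for
    \<open>i < 2 * m\<close>, the product \<open>(1 - e) * s\<close> telescopes, and the element
    becomes \<open>(1 - e) * (1 - e) * s + e\<close>, a sum of positive terms.\<close>
  have poly: "1 - (1 - e) * e ^ (2 * m) \<in> pos" if e: "e \<in> pos" for e :: 'a and m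
  proof -
    define s where "s = (\<Sum>i<2 * m. e ^ i)"
    have "(1 - e) * s = 1 - e ^ (2 * m)"
    proof -
      have "(1 - e) * (\<Sum>i<n. e ^ i) = 1 - e ^ n" for n
        by (induction n) (simp_all add: distrib_left left_diff_distrib)
      then show ?thesis by (simp add: s_def)
    qed
    have es: "e * s = s * e"
      by (simp add: s_def sum_distrib_left sum_distrib_right power_commutes)
    have "s \<in> pos" unfolding s_def by (intro pos_sum pos_power e)
    have se: "star e = e" by (rule pos_selfadjoint[OF e])
    have "((1 - e) * (1 - e)) * s \<in> pos"
    proof (rule pos_mult_commute[OF square_in_pos \<open>s \<in> pos\<close>])
      show "star (1 - e) = 1 - e" using se by (simp add: star_diff)
      have "s * (1 - e) = (1 - e) * s" using es by (simp add: algebra_simps)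
      then show "(1 - e) * (1 - e) * s = s * ((1 - e) * (1 - e))" by (metis mult.assoc)
    qed
    then have "((1 - e) * (1 - e)) * s + e \<in> pos" using e by (rule pos_add)
    also have "((1 - e) * (1 - e)) * s + e = 1 - (1 - e) * e ^ (2 * m)"
      unfolding mult.assoc \<open>(1 - e) * s = _\<close> by (simp add: algebra_simps)
    finally show ?thesis .
  qed
  \<comment> \<open>\<open>x\<close> intertwines \<open>c = 1 - star x * x\<close> with
    \<open>d = 1 - x * star x\<close>; this turns \<open>y * star y\<close> into the same polynomial
    in \<open>d\<close> that \<open>star y * y\<close> is in \<open>c\<close>.\<close>
  have xc: "x * c ^ n = d ^ n * x" for n
  proof (induction n)
    case (Suc n)
    have "x * c ^ Suc n = x * c ^ n * c" by (simp add: power_commutes mult.assoc)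
    also have "\<dots> = d ^ n * (x * c)" using Suc by (simp add: mult.assoc)
    also have "x * c = d * x" by (simp add: c_def d_def a_def b_def algebra_simps)
    finally show ?case by (simp add: power_commutes flip: mult.assoc)
  qed simp
  have sc: "star c = c" using c by (rule pos_selfadjoint)
  have bound: "norm ((1 - c) * c ^ (2 * m)) \<le> 1" for m
  proof -
    define y where "y = x * c ^ m"
    have sy: "star y = c ^ m * star x" by (simp add: y_def star_mult star_power sc)
    have "star y * y = c ^ m * (a * c ^ m)" unfolding sy by (simp add: y_def a_def mult.assoc)
    moreover have ac: "a * c ^ m = c ^ m * a"
    proof (rule power_commuting_commutes[symmetric])
      show "c * a = a * c" by (simp add: c_def algebra_simps)
    qed
    ultimately have "star y * y = a * c ^ (2 * m)"
      by (metis mult.assoc mult_2 power_add)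
    then have 1: "star y * y = (1 - c) * c ^ (2 * m)" by (simp add: c_def)
    have "y * star y = x * c ^ (2 * m) * star x"
      unfolding sy by (simp add: y_def mult_2 power_add mult.assoc)
    also have "\<dots> = d ^ (2 * m) * b" by (simp add: xc b_def mult.assoc)
    also have "\<dots> = b * d ^ (2 * m)"
      by (rule power_commuting_commutes) (simp add: d_def algebra_simps)
    finally have 2: "y * star y = (1 - d) * d ^ (2 * m)" by (simp add: d_def)
    \<comment> \<open>\<open>h\<close> and \<open>k\<close> are the real and imaginary parts of
      \<open>y\<close>, so \<open>star y * y + y * star y = 2 *\<^sub>R (h * h + k * k)\<close> is
      positive. Adding the positive element \<open>1 - y * star y\<close> bounds
      \<open>star y * y\<close> below by \<open>- 1\<close>.\<close>
    define h where "h = (1/2) *\<^sub>R (y + star y)"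
    define k where "k = scaleC (\<i>/2) (star y - y)"
    have hk: "star h = h" "star k = k"
      by (simp_all add: h_def k_def star_add star_scaleC star_diff algebra_simps scaleC_diff_right)
    have "\<i> / 2 * (\<i> / 2) = complex_of_real (- (1/4))"
      by (simp add: complex_eq_iff)
    then have kk: "k * k = (1/4) *\<^sub>R (- ((star y - y) * (star y - y)))"
      unfolding k_def mult_scaleC_left mult_scaleC_right scaleC_scaleC
      by (simp only: scaleC_of_real) simp
    have "2 *\<^sub>R (h * h + k * k) = star y * y + y * star y"
      unfolding kk by (simp add: h_def algebra_simps flip: scaleR_add_left)
    moreover have "2 *\<^sub>R (h * h + k * k) \<in> pos"
      by (intro pos_scaleR pos_add square_in_pos hk) simp
    ultimately have "(1 - y * star y) + (star y * y + y * star y) \<in> pos"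
      using pos_add[OF poly[OF d, of m], folded 2] by metis
    then have "of_real 1 + star y * y \<in> pos" by simp
    moreover have "of_real 1 - star y * y \<in> pos"
      using poly[OF c, of m] by (simp add: 1)
    ultimately have "norm (star y * y) \<le> 1"
      by (intro norm_le_of_pos) (simp_all add: star_mult)
    then show ?thesis by (simp add: 1)
  qed
  have "norm c \<le> 1"
  proof (rule ccontr)
    assume "\<not> norm c \<le> 1"
    then have g: "norm c > 1" by simp
    \<comment> \<open>By \<open>norm_selfadjoint_power\<close>, \<open>(1 - c) * c ^ (2 * m)\<close>
      has norm at least \<open>norm c ^ (2 * m) * (norm c - 1)\<close>, which is unbounded in
      \<open>m\<close> if \<open>norm c > 1\<close>.\<close>
    have le: "norm c ^ (2 * m) \<le> 1 / (norm c - 1)" for m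
    proof -
      have "norm c ^ (2 * m) * (norm c - 1) = norm (c ^ (2 * m + 1)) - norm (c ^ (2 * m))"
        by (simp add: norm_selfadjoint_power sc algebra_simps del: power_Suc) simp
      also have "\<dots> \<le> norm (c ^ (2 * m) - c ^ (2 * m + 1))"
        by (metis norm_minus_commute norm_triangle_ineq2)
      also have "c ^ (2 * m) - c ^ (2 * m + 1) = (1 - c) * c ^ (2 * m)"
        by (simp add: algebra_simps)
      finally show ?thesis using bound[of m] g by (simp add: field_simps)
    qed
    obtain n where "1 / (norm c - 1) < (norm c)\<^sup>2 ^ n"
      using real_arch_pow[of "(norm c)\<^sup>2" "1 / (norm c - 1)"] g
      by (auto simp: power2_eq_square less_1_mult)
    then show False using le[of n] by (simp add: power_mult)
  qed
  then show ?thesis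
    using sa by (intro posI[where t = 1]) (simp_all add: a_def c_def)
qed

lemma star_mult_self_in_pos: "star x * x \<in> (pos :: 'a::cstar_algebra set)"
proof (cases "x = 0")
  case False
  define y where "y = (1 / norm x) *\<^sub>R x"
  have "star y * y \<in> pos"
    using False by (intro star_mult_self_in_pos_aux) (simp add: y_def)
  then have "(norm x)\<^sup>2 *\<^sub>R (star y * y) \<in> pos" by (intro pos_scaleR) auto
  moreover have "(norm x)\<^sup>2 *\<^sub>R (star y * y) = star x * x"
    using False by (simp add: y_def power2_eq_square)
  ultimately show ?thesis by simp
qed (simp add: zero_in_pos)

lemma conjugate_in_pos:
  fixes a x :: "'a::cstar_algebra"
  assumes "a \<in> pos"
  shows "star x * a * x \<in> pos"
proof (rule pos_eps_limit)
  show "star x * (a + of_real e) * x \<in> pos" if "0 < e" for e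
  proof -
    obtain h where h: "star h = h" "h * h = a + of_real e"
      using pos_eps_square[OF assms \<open>0 < e\<close>] by metis
    have "star (h * x) * (h * x) \<in> pos" by (rule star_mult_self_in_pos)
    then show ?thesis by (simp add: star_mult h mult.assoc flip: h(2))
  qed
  have "((\<lambda>e. star x * (a + of_real e) * x) \<longlongrightarrow> star x * (a + of_real 0) * x) (at_right (0::real))"
    by (intro tendsto_intros)
  then show "((\<lambda>e. star x * (a + of_real e) * x) \<longlongrightarrow> star x * a * x) (at_right (0::real))"
    by simp
qed

subsection \<open>Matrices over a C*-algebra\<close>

definition inner_prod :: "'a::cstar_algebra^'n \<Rightarrow> 'a^'n \<Rightarrow> 'a" where
  "inner_prod v w = (\<Sum>i\<in>UNIV. star (v $ i) * w $ i)"

lemma inner_prod_add_left: "inner_prod (u + v) w = inner_prod u w + inner_prod v w"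
  by (simp add: inner_prod_def star_add distrib_right sum.distrib)

lemma inner_prod_add_right: "inner_prod u (v + w) = inner_prod u v + inner_prod u w"
  by (simp add: inner_prod_def distrib_left sum.distrib)

lemma inner_prod_diff_left: "inner_prod (u - v) w = inner_prod u w - inner_prod v w"
  by (simp add: inner_prod_def star_diff left_diff_distrib sum_subtractf)

lemma inner_prod_diff_right: "inner_prod u (v - w) = inner_prod u v - inner_prod u w"
  by (simp add: inner_prod_def right_diff_distrib sum_subtractf)

lemma inner_prod_scaleR_left [simp]: "inner_prod (r *\<^sub>R u) w = r *\<^sub>R inner_prod u w"
  by (simp add: inner_prod_def scaleR_sum_right)

lemma inner_prod_scaleR_right [simp]: "inner_prod u (r *\<^sub>R w) = r *\<^sub>R inner_prod u w"
  by (simp add: inner_prod_def scaleR_sum_right)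

lemma inner_prod_mult_right: "inner_prod u (\<chi> i. v $ i * a) = inner_prod u v * a"
  by (simp add: inner_prod_def sum_distrib_right mult.assoc)

lemma inner_prod_mult_left: "inner_prod (\<chi> i. u $ i * a) v = star a * inner_prod u v"
  by (simp add: inner_prod_def sum_distrib_left star_mult mult.assoc)

lemma star_inner_prod [simp]: "star (inner_prod u v) = inner_prod v u"
  by (simp add: inner_prod_def star_sum star_mult)

lemma inner_prod_self_in_pos: "inner_prod v v \<in> pos"
  unfolding inner_prod_def by (intro pos_sum star_mult_self_in_pos)

lemma module_norm_eq: "module_norm v = sqrt (norm (inner_prod v v))"
  by (simp add: module_norm_def inner_prod_def)

lemma module_norm_square: "(module_norm v)\<^sup>2 = norm (inner_prod v v)"
  by (simp add: module_norm_eq)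

lemma module_norm_nonneg [simp]: "0 \<le> module_norm v"
  by (simp add: module_norm_eq)

lemma module_norm_scaleR: "module_norm (r *\<^sub>R v) = \<bar>r\<bar> * module_norm v"
  by (simp add: module_norm_eq real_sqrt_mult flip: mult.assoc)

lemma module_norm_scaleC: "module_norm (\<chi> i. scaleC c (v $ i)) = cmod c * module_norm v"
proof -
  have "c * cnj c = complex_of_real ((cmod c)\<^sup>2)"
    by (simp only: complex_norm_square)
  then have "inner_prod (\<chi> i. scaleC c (v $ i)) (\<chi> i. scaleC c (v $ i)) = (cmod c)\<^sup>2 *\<^sub>R inner_prod v v"
    by (simp add: inner_prod_def star_scaleC mult_scaleC_left mult_scaleC_right scaleC_scaleC
        scaleC_of_real scaleR_sum_right del: of_real_power)
  then show ?thesis by (simp add: module_norm_eq real_sqrt_mult)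
qed

lemma module_norm_zero [simp]: "module_norm 0 = 0"
  by (simp add: module_norm_eq inner_prod_def)

lemma norm_component_le: "norm (v $ i) \<le> module_norm (v :: 'a::cstar_algebra^'n)"
proof -
  have "norm (star (v $ i) * v $ i) \<le> norm (inner_prod v v)"
  proof (rule norm_mono_pos)
    have "inner_prod v v = star (v $ i) * v $ i + (\<Sum>j\<in>UNIV - {i}. star (v $ j) * v $ j)"
      unfolding inner_prod_def by (intro sum.remove) auto
    then show "inner_prod v v - star (v $ i) * v $ i \<in> pos"
      by (auto intro!: pos_sum star_mult_self_in_pos)
  qed (rule star_mult_self_in_pos)
  then have "(norm (v $ i))\<^sup>2 \<le> (module_norm v)\<^sup>2"
    by (simp add: norm_star_mult_self module_norm_square)
  then show ?thesis by (rule power2_le_imp_le) simp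
qed

text \<open>The inner square of \<open>z = v s - w\<close>, with \<open>s = inner_prod v w\<close>
  acting on the right, is positive; for \<open>norm (inner_prod v v) \<le> 1\<close> this leaves
  \<open>inner_prod w w - star s * s\<close> positive. Normalizing \<open>v\<close> by its scalar
  norm avoids inverting the algebra element \<open>inner_prod v v\<close>.\<close>

lemma inner_prod_cauchy_schwarz:
  fixes v w :: "'a::cstar_algebra^'n"
  shows "norm (inner_prod v w) \<le> module_norm v * module_norm w"
proof -
  have le: "norm (inner_prod v w) \<le> module_norm w" if v: "module_norm v \<le> 1" for v w :: "'a^'n"
  proof -
    define s where "s = inner_prod v w"
    define z where "z = (\<chi> i. v $ i * s) - w"
    have nv: "norm (inner_prod v v) \<le> 1"
      using v by (simp flip: module_norm_square add: power_le_one)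
    have "inner_prod z z = star s * inner_prod v v * s - 2 *\<^sub>R (star s * s) + inner_prod w w"
    proof -
      have "inner_prod w v = star s" by (simp add: s_def)
      then show ?thesis
        by (simp add: z_def inner_prod_diff_left inner_prod_diff_right inner_prod_mult_left
            inner_prod_mult_right s_def[symmetric] scaleR_2 algebra_simps)
    qed
    moreover have "star s * (of_real 1 - inner_prod v v) * s \<in> pos"
      by (intro conjugate_in_pos of_real_minus_in_pos nv) simp
    moreover have "star s * (of_real 1 - inner_prod v v) * s = star s * s - star s * inner_prod v v * s"
      by (simp add: algebra_simps)
    ultimately have "inner_prod w w - star s * s \<in> pos"
      using pos_add[OF inner_prod_self_in_pos[of z], of "star s * s - star s * inner_prod v v * s"]
      by (simp add: scaleR_2)
    then have "(norm s)\<^sup>2 \<le> (module_norm w)\<^sup>2"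
      using norm_mono_pos[OF star_mult_self_in_pos[of s]]
      by (simp add: norm_star_mult_self module_norm_square)
    then show ?thesis unfolding s_def by (rule power2_le_imp_le) simp
  qed
  show ?thesis
  proof (cases "module_norm v = 0")
    case True
    then have "v $ i = 0" for i using norm_component_le[of v i] by simp
    then show ?thesis by (simp add: inner_prod_def)
  next
    case False
    then have p: "module_norm v > 0" by (simp add: less_le)
    define u where "u = (1 / module_norm v) *\<^sub>R v"
    have "norm (inner_prod u w) \<le> module_norm w"
      using p by (intro le) (simp add: u_def module_norm_scaleR)
    with p show ?thesis by (simp add: u_def divide_simps mult.commute)
  qed
qed

lemma module_norm_triangle: "module_norm (v + w) \<le> module_norm v + module_norm w"
proof (rule power2_le_imp_le)
  have "(module_norm (v + w))\<^sup>2
      = norm (inner_prod v v + inner_prod v w + (inner_prod w v + inner_prod w w))"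
    by (simp add: module_norm_square inner_prod_add_left inner_prod_add_right add_ac)
  also have "\<dots> \<le> (norm (inner_prod v v) + norm (inner_prod v w))
      + (norm (inner_prod w v) + norm (inner_prod w w))"
    by (meson add_mono norm_triangle_ineq order_trans)
  also have "\<dots> \<le> ((module_norm v)\<^sup>2 + module_norm v * module_norm w)
      + (module_norm w * module_norm v + (module_norm w)\<^sup>2)"
    by (intro add_mono inner_prod_cauchy_schwarz) (simp_all add: module_norm_square)
  also have "\<dots> = (module_norm v + module_norm w)\<^sup>2"
    by (simp add: power2_eq_square algebra_simps)
  finally show "(module_norm (v + w))\<^sup>2 \<le> (module_norm v + module_norm w)\<^sup>2" .
qed simp

lemma module_norm_le_sum: "module_norm v \<le> (\<Sum>i\<in>UNIV. norm (v $ i :: 'a::cstar_algebra))"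
proof -
  have "norm (inner_prod v v) \<le> (\<Sum>i\<in>UNIV. norm (star (v $ i) * v $ i))"
    unfolding inner_prod_def by (rule norm_sum)
  then have "module_norm v \<le> L2_set (\<lambda>i. norm (v $ i)) UNIV"
    by (simp add: module_norm_eq L2_set_def norm_star_mult_self)
  also have "\<dots> \<le> (\<Sum>i\<in>UNIV. norm (v $ i))"
    by (rule L2_set_le_sum) simp
  finally show ?thesis .
qed

lemma module_norm_eq_0_iff [simp]: "module_norm v = 0 \<longleftrightarrow> v = 0"
proof
  assume "module_norm v = 0"
  then have "v $ i = 0" for i using norm_component_le[of v i] by simp
  then show "v = 0" by (simp add: vec_eq_iff)
qed simp

section \<open>The operator norm on \<open>M_n(A)\<close>\<close>

lemma matrix_vector_scaleR: "A *v (r *\<^sub>R v) = r *\<^sub>R (A *v (v :: 'a::cstar_algebra^'n))"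
  by (simp add: vec_eq_iff matrix_vector_mult_def scaleR_sum_right)

text \<open>This crude bound makes the supremum in \<open>cmat_norm\<close> finite and, with
  \<open>norm_entry_le\<close>, identifies norm convergence of matrices with convergence of the
  entries.\<close>

lemma module_norm_matrix_le_sum:
  fixes M :: "'a::cstar_algebra^'n^'n"
  assumes "module_norm v \<le> 1"
  shows "module_norm (M *v v) \<le> (\<Sum>i\<in>UNIV. \<Sum>j\<in>UNIV. norm (M $ i $ j))"
proof -
  have "norm ((M *v v) $ i) \<le> (\<Sum>j\<in>UNIV. norm (M $ i $ j))" for i
  proof -
    have "norm ((M *v v) $ i) \<le> (\<Sum>j\<in>UNIV. norm (M $ i $ j * v $ j))"
      unfolding matrix_vector_mult_def by (simp add: norm_sum)
    also have "\<dots> \<le> (\<Sum>j\<in>UNIV. norm (M $ i $ j))"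
    proof (rule sum_mono)
      fix j
      have "norm (v $ j) \<le> 1" using norm_component_le[of v j] assms by simp
      then show "norm (M $ i $ j * v $ j) \<le> norm (M $ i $ j)"
        using norm_mult_ineq[of "M $ i $ j" "v $ j"] by (meson mult_left_le norm_ge_zero order_trans)
    qed
    finally show ?thesis .
  qed
  then show ?thesis
    using module_norm_le_sum[of "M *v v"] by (meson order_trans sum_mono)
qed

lemma bdd_above_cmat_norm:
  "bdd_above ((\<lambda>v. module_norm (entries M *v v)) ` {v. module_norm v \<le> 1})"
  using module_norm_matrix_le_sum by (intro bdd_aboveI2) blast

lemma cmat_norm_le_sum: "cmat_norm M \<le> (\<Sum>i\<in>UNIV. \<Sum>j\<in>UNIV. norm (entries M $ i $ j))"
  unfolding cmat_norm_def
  by (rule cSUP_least) (auto intro!: module_norm_matrix_le_sum exI[of _ 0])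

lemma cmat_norm_leI:
  "(\<And>v. module_norm v \<le> 1 \<Longrightarrow> module_norm (entries M *v v) \<le> c) \<Longrightarrow> cmat_norm M \<le> c"
  unfolding cmat_norm_def by (rule cSUP_least) (auto intro!: exI[of _ 0])

lemma cmat_norm_upper: "module_norm v \<le> 1 \<Longrightarrow> module_norm (entries M *v v) \<le> cmat_norm M"
  unfolding cmat_norm_def by (rule cSUP_upper[OF _ bdd_above_cmat_norm]) simp

lemma cmat_norm_nonneg [simp]: "0 \<le> cmat_norm M"
  using cmat_norm_upper[of 0 M] order_trans[OF module_norm_nonneg] by simp

lemma module_norm_mult_le: "module_norm (entries M *v v) \<le> cmat_norm M * module_norm v"
proof (cases "v = 0")
  case False
  then have p: "0 < module_norm v" using module_norm_nonneg[of v] by (simp add: less_le)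
  then have "module_norm (entries M *v ((1 / module_norm v) *\<^sub>R v)) \<le> cmat_norm M"
    by (intro cmat_norm_upper) (simp add: module_norm_scaleR)
  with p show ?thesis by (simp add: matrix_vector_scaleR module_norm_scaleR divide_simps)
qed simp

lemma norm_entry_le: "norm (entries M $ i $ j) \<le> cmat_norm (M :: ('a::cstar_algebra, 'n::finite) cmat)"
proof -
  have "module_norm (axis j 1 :: 'a^'n) \<le> 1"
    using module_norm_le_sum[of "axis j 1 :: 'a^'n"] by (simp add: axis_def if_distrib cong: if_cong)
  then have "module_norm (entries M *v axis j 1) \<le> cmat_norm M" by (rule cmat_norm_upper)
  moreover have "(entries M *v axis j 1) $ i = entries M $ i $ j"
    by (simp add: matrix_vector_mult_def axis_def if_distrib cong: if_cong)
  ultimately show ?thesis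
    using norm_component_le[of "entries M *v axis j 1" i] by simp
qed

lemma inner_prod_star_matrix:
  "inner_prod v (entries M *v w) = inner_prod (entries (star M) *v v) w"
proof -
  have "inner_prod v (entries M *v w) = (\<Sum>i\<in>UNIV. \<Sum>j\<in>UNIV. star (v $ i) * entries M $ i $ j * w $ j)"
    by (simp add: inner_prod_def matrix_vector_mult_def sum_distrib_left mult.assoc)
  also have "\<dots> = (\<Sum>j\<in>UNIV. \<Sum>i\<in>UNIV. star (v $ i) * entries M $ i $ j * w $ j)"
    by (rule sum.swap)
  also have "\<dots> = inner_prod (entries (star M) *v v) w"
    by (simp add: inner_prod_def matrix_vector_mult_def sum_distrib_right star_sum star_mult
        star_cmat.rep_eq)
  finally show ?thesis .
qed

lemma cmat_eq_iff: "M = N \<longleftrightarrow> (\<forall>i j. entries M $ i $ j = entries N $ i $ j)"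
  by (simp add: entries_inject[symmetric] vec_eq_iff)

lemma cmat_norm_scaleC:
  "cmat_norm (scaleC c M) = cmod c * cmat_norm (M :: ('a::cstar_algebra, 'n::finite) cmat)"
proof -
  have eq: "entries (scaleC c M) *v v = (\<chi> i. scaleC c ((entries M *v v) $ i))"
    for c and M :: "('a, 'n) cmat" and v
    by (simp add: vec_eq_iff scaleC_cmat.rep_eq matrix_vector_mult_def scaleC_sum mult_scaleC_left)
  have le: "cmat_norm (scaleC c M) \<le> cmod c * cmat_norm M" for c and M :: "('a, 'n) cmat"
    by (rule cmat_norm_leI) (simp add: eq module_norm_scaleC mult_left_mono cmat_norm_upper)
  show ?thesis
  proof (cases "c = 0")
    case True
    then show ?thesis using le[of c M] by (simp add: antisym)
  next
    case False
    have "scaleC (inverse c) (scaleC c M) = M"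
      using False by (simp add: cmat_eq_iff scaleC_cmat.rep_eq scaleC_scaleC)
    then have "cmod c * cmat_norm M \<le> cmat_norm (scaleC c M)"
      using le[of "inverse c" "scaleC c M"] False by (simp add: norm_inverse norm_divide field_simps)
    with le show ?thesis by (simp add: antisym)
  qed
qed

section \<open>\<open>M_n(A)\<close> as a C*-algebra\<close>

instance cmat :: ("{real_vector, ring_1}", finite) real_vector
  by standard (simp_all add: cmat_eq_iff scaleR_cmat.rep_eq plus_cmat.rep_eq scaleR_add_right scaleR_add_left)

instantiation cmat :: (cstar_algebra, finite) uniformity_dist
begin

definition dist_cmat :: "('a, 'b) cmat \<Rightarrow> ('a, 'b) cmat \<Rightarrow> real"
  where "dist_cmat M N = cmat_norm (M - N)"
definition uniformity_cmat :: "(('a, 'b) cmat \<times> ('a, 'b) cmat) filter"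
  where "uniformity_cmat = (INF e\<in>{0 <..}. principal {(x, y). dist x y < e})"

instance by standard (rule uniformity_cmat_def)

end

instantiation cmat :: (cstar_algebra, finite) real_normed_algebra_1
begin

definition norm_cmat :: "('a, 'b) cmat \<Rightarrow> real" where "norm_cmat = cmat_norm"
definition sgn_cmat :: "('a, 'b) cmat \<Rightarrow> ('a, 'b) cmat"
  where "sgn_cmat M = M /\<^sub>R norm M"

instance
proof
  fix M N :: "('a, 'b) cmat" and r :: real and S :: "('a, 'b) cmat set"
  show tri: "norm (M + N) \<le> norm M + norm N" for M N :: "('a, 'b) cmat"
    unfolding norm_cmat_def
  proof (rule cmat_norm_leI)
    fix v :: "'a^'b" assume v: "module_norm v \<le> 1"
    have "entries (M + N) *v v = entries M *v v + entries N *v v"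
      by (simp add: plus_cmat.rep_eq matrix_vector_mult_add_rdistrib)
    then show "module_norm (entries (M + N) *v v) \<le> cmat_norm M + cmat_norm N"
      using module_norm_triangle[of "entries M *v v" "entries N *v v"]
        cmat_norm_upper[OF v, of M] cmat_norm_upper[OF v, of N] by simp
  qed
  show "norm M = 0 \<longleftrightarrow> M = 0"
  proof
    assume "norm M = 0"
    then have "norm (entries M $ i $ j) \<le> 0" for i j
      using norm_entry_le[of M i j] by (simp add: norm_cmat_def)
    then show "M = 0" by (simp add: cmat_eq_iff zero_cmat.rep_eq)
  next
    assume "M = 0"
    then have "norm M \<le> 0"
      using cmat_norm_le_sum[of M] by (simp add: norm_cmat_def zero_cmat.rep_eq)
    then show "norm M = 0" using cmat_norm_nonneg[of M] by (simp add: norm_cmat_def)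
  qed
  show scale: "norm (r *\<^sub>R M) = \<bar>r\<bar> * norm M" for r and M :: "('a, 'b) cmat"
  proof -
    have "r *\<^sub>R M = scaleC (complex_of_real r) M"
      by (simp add: cmat_eq_iff scaleC_cmat.rep_eq scaleR_cmat.rep_eq scaleC_of_real)
    then show ?thesis by (simp add: norm_cmat_def cmat_norm_scaleC)
  qed
  show mult: "norm (M * N) \<le> norm M * norm N"
    unfolding norm_cmat_def
  proof (rule cmat_norm_leI)
    fix v :: "'a^'b" assume v: "module_norm v \<le> 1"
    have "module_norm (entries (M * N) *v v) \<le> cmat_norm M * module_norm (entries N *v v)"
      by (simp add: times_cmat.rep_eq matrix_vector_mul_assoc[symmetric] module_norm_mult_le)
    also have "\<dots> \<le> cmat_norm M * cmat_norm N"
      by (intro mult_left_mono cmat_norm_upper v) simp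
    finally show "module_norm (entries (M * N) *v v) \<le> cmat_norm M * cmat_norm N" .
  qed
  show "norm (1 :: ('a, 'b) cmat) = 1"
  proof (rule antisym)
    show "norm (1 :: ('a, 'b) cmat) \<le> 1"
      unfolding norm_cmat_def by (rule cmat_norm_leI) (simp add: one_cmat.rep_eq)
    show "1 \<le> norm (1 :: ('a, 'b) cmat)"
      using norm_entry_le[of "1 :: ('a, 'b) cmat" undefined undefined]
      by (simp add: norm_cmat_def one_cmat.rep_eq mat_def)
  qed
  show "r *\<^sub>R M * N = r *\<^sub>R (M * N)" "M * r *\<^sub>R N = r *\<^sub>R (M * N)"
    by (simp_all add: cmat_eq_iff times_cmat.rep_eq scaleR_cmat.rep_eq matrix_matrix_mult_def
        scaleR_sum_right)
  show "dist M N = norm (M - N)" by (simp add: dist_cmat_def norm_cmat_def)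
  show "sgn M = M /\<^sub>R norm M" by (rule sgn_cmat_def)
  \<comment> \<open>The open sets were defined through \<open>cmat_norm\<close> before any metric,
    so their agreement with the uniformity has to be checked; it comes down to
    \<open>norm (N - M) = dist M N\<close>.\<close>
  show "open S \<longleftrightarrow> (\<forall>M\<in>S. \<forall>\<^sub>F (M', N) in uniformity. M' = M \<longrightarrow> N \<in> S)"
  proof -
    have "norm (N - M) = dist M N" for M N :: "('a, 'b) cmat"
      using scale[of "- 1" "M - N"] by (simp add: norm_cmat_def dist_cmat_def)
    then show ?thesis
      unfolding open_cmat_def eventually_uniformity_metric by (simp add: norm_cmat_def)
  qed
qed

end

text \<open>\<open>norm_entry_le\<close> makes the entries Cauchy, and
  \<open>cmat_norm_le_sum\<close> turns their limits into a limit in norm.\<close>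

instance cmat :: (cstar_algebra, finite) banach
proof
  fix X :: "nat \<Rightarrow> ('a, 'b) cmat" assume X: "Cauchy X"
  have "Cauchy (\<lambda>n. entries (X n) $ i $ j)" for i j
    unfolding Cauchy_def
  proof (intro allI impI)
    fix e :: real assume "0 < e"
    then obtain K where K: "\<forall>m\<ge>K. \<forall>n\<ge>K. dist (X m) (X n) < e"
      using X unfolding Cauchy_def by blast
    have "dist (entries (X m) $ i $ j) (entries (X n) $ i $ j) \<le> dist (X m) (X n)" for m n
      using norm_entry_le[of "X m - X n" i j]
      by (simp add: dist_norm norm_cmat_def minus_cmat.rep_eq)
    with K show "\<exists>K. \<forall>m\<ge>K. \<forall>n\<ge>K. dist (entries (X m) $ i $ j) (entries (X n) $ i $ j) < e"
      by (meson le_less_trans)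
  qed
  then have "\<exists>l. (\<lambda>n. entries (X n) $ i $ j) \<longlonglongrightarrow> l" for i j
    using Cauchy_convergent convergent_def by blast
  then obtain L where L: "\<And>i j. (\<lambda>n. entries (X n) $ i $ j) \<longlonglongrightarrow> L i j" by metis
  define l :: "('a, 'b) cmat" where "l = CMat (\<chi> i j. L i j)"
  have l: "entries l $ i $ j = L i j" for i j by (simp add: l_def CMat_inverse)
  have "(\<lambda>n. X n - l) \<longlonglongrightarrow> 0"
  proof (rule Lim_null_comparison)
    show "\<forall>\<^sub>F n in sequentially. norm (X n - l)
        \<le> (\<Sum>i\<in>UNIV. \<Sum>j\<in>UNIV. norm (entries (X n) $ i $ j - L i j))"
      using cmat_norm_le_sum[of "X _ - l"]
      by (intro always_eventually allI) (simp add: norm_cmat_def minus_cmat.rep_eq l)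
    have "(\<lambda>n. \<Sum>i\<in>UNIV. \<Sum>j\<in>UNIV. norm (entries (X n) $ i $ j - L i j))
        \<longlonglongrightarrow> (\<Sum>i\<in>UNIV. \<Sum>j\<in>(UNIV::'b set). norm (L i j - L i j))"
      by (intro tendsto_intros L)
    then show "(\<lambda>n. \<Sum>i\<in>UNIV. \<Sum>j\<in>UNIV. norm (entries (X n) $ i $ j - L i j)) \<longlonglongrightarrow> 0"
      by simp
  qed
  then show "convergent X" unfolding convergent_def by (auto simp: LIM_zero_iff)
qed

text \<open>For \<open>w = star M v\<close>, the square of \<open>module_norm w\<close> is the norm
  of the inner product of \<open>v\<close> with \<open>M w\<close>, hence at most
  \<open>cmat_norm M * module_norm w\<close>; one factor cancels.\<close>

lemma cmat_norm_star_le: "norm (star M) \<le> norm (M :: ('a::cstar_algebra, 'n::finite) cmat)"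
  unfolding norm_cmat_def
proof (rule cmat_norm_leI)
  fix v :: "'a^'n" assume v: "module_norm v \<le> 1"
  let ?w = "entries (star M) *v v"
  have "(module_norm ?w)\<^sup>2 = norm (inner_prod v (entries M *v ?w))"
    by (simp add: module_norm_square inner_prod_star_matrix)
  also have "\<dots> \<le> module_norm v * module_norm (entries M *v ?w)"
    by (rule inner_prod_cauchy_schwarz)
  also have "\<dots> \<le> 1 * (cmat_norm M * module_norm ?w)"
    by (intro mult_mono v module_norm_mult_le) auto
  finally have "module_norm ?w * module_norm ?w \<le> cmat_norm M * module_norm ?w"
    by (simp add: power2_eq_square)
  then show "module_norm ?w \<le> cmat_norm M"
    by (cases "module_norm ?w = 0") (auto simp: less_le mult_le_cancel_right)
qed

instance cmat :: (cstar_algebra, finite) cstar_algebra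
proof
  fix M N :: "('a, 'b) cmat" and c d :: complex and r :: real
  show "scaleC c (M + N) = scaleC c M + scaleC c N"
    by (simp add: cmat_eq_iff scaleC_cmat.rep_eq plus_cmat.rep_eq scaleC_add_right)
  show "scaleC (c + d) M = scaleC c M + scaleC d M"
    by (simp add: cmat_eq_iff scaleC_cmat.rep_eq plus_cmat.rep_eq scaleC_add_left)
  show "scaleC c (scaleC d M) = scaleC (c * d) M"
    by (simp add: cmat_eq_iff scaleC_cmat.rep_eq scaleC_scaleC)
  show "scaleC (complex_of_real r) M = r *\<^sub>R M"
    by (simp add: cmat_eq_iff scaleC_cmat.rep_eq scaleR_cmat.rep_eq scaleC_of_real)
  show "scaleC c M * N = scaleC c (M * N)" "M * scaleC c N = scaleC c (M * N)"
    by (simp_all add: cmat_eq_iff scaleC_cmat.rep_eq times_cmat.rep_eq matrix_matrix_mult_def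
        scaleC_sum mult_scaleC_left mult_scaleC_right)
  show "star (star M) = M"
    by (simp add: cmat_eq_iff star_cmat.rep_eq)
  show "star (M + N) = star M + star N"
    by (simp add: cmat_eq_iff star_cmat.rep_eq plus_cmat.rep_eq star_add)
  show "star (M * N) = star N * star M"
    by (simp add: cmat_eq_iff star_cmat.rep_eq times_cmat.rep_eq matrix_matrix_mult_def
        star_sum star_mult)
  show "star (scaleC c M) = scaleC (cnj c) (star M)"
    by (simp add: cmat_eq_iff star_cmat.rep_eq scaleC_cmat.rep_eq star_scaleC)
  show "norm (scaleC c M) = cmod c * norm M"
    by (simp add: norm_cmat_def cmat_norm_scaleC)
  show "norm (star M * M) = (norm M)\<^sup>2"
  proof (rule antisym)
    have "norm (star M * M) \<le> norm (star M) * norm M" by (rule norm_mult_ineq)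
    also have "\<dots> \<le> norm M * norm M" by (intro mult_right_mono cmat_norm_star_le) simp
    finally show "norm (star M * M) \<le> (norm M)\<^sup>2" by (simp add: power2_eq_square)
    \<comment> \<open>Moving one \<open>M\<close> across the inner product and applying
      Cauchy-Schwarz bounds the square of each \<open>module_norm (M v)\<close> by the norm of
      \<open>star M * M\<close>.\<close>
    have "norm M \<le> sqrt (norm (star M * M))"
      unfolding norm_cmat_def
    proof (rule cmat_norm_leI, rule real_le_rsqrt)
      fix v :: "'a^'b" assume v: "module_norm v \<le> 1"
      have "(module_norm (entries M *v v))\<^sup>2 = norm (inner_prod (entries (star M * M) *v v) v)"
        by (simp add: module_norm_square inner_prod_star_matrix times_cmat.rep_eq
            matrix_vector_mul_assoc[symmetric])
      also have "\<dots> \<le> module_norm (entries (star M * M) *v v) * module_norm v"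
        by (rule inner_prod_cauchy_schwarz)
      also have "\<dots> \<le> cmat_norm (star M * M) * 1"
        by (intro mult_mono v cmat_norm_upper) auto
      finally show "(module_norm (entries M *v v))\<^sup>2 \<le> cmat_norm (star M * M)" by simp
    qed
    then show "(norm M)\<^sup>2 \<le> norm (star M * M)"
      using power_mono[of "norm M" _ 2] by fastforce
  qed
qed

subsection \<open>Exponentials\<close>

text \<open>The tail of the series is dominated termwise by the real tail at \<open>norm y\<close>,
  and \<open>exp t \<le> 1 + t + t^2\<close> on the unit interval.\<close>

lemma norm_exp_minus_linear:
  fixes y :: "'a::{real_normed_algebra_1,banach}"
  assumes "norm y \<le> 1"
  shows "norm (exp y - 1 - y) \<le> (norm y)\<^sup>2"
proof -
  let ?f = "\<lambda>n. inverse (fact (n + 2)) *\<^sub>R y ^ (n + 2)"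
  let ?g = "\<lambda>n. inverse (fact (n + 2)) *\<^sub>R norm y ^ (n + 2)"
  have "norm (suminf ?f) \<le> suminf ?g"
  proof (rule norm_suminf_le)
    show "norm (?f n) \<le> ?g n" for n
      by (simp del: fact_Suc power_Suc add: mult_left_mono norm_power_ineq)
    show "summable ?g"
      using summable_ignore_initial_segment[OF summable_exp_generic[of "norm y"], of 2]
      by (simp del: fact_Suc power_Suc)
  qed
  moreover have "exp y - 1 - y = suminf ?f"
    using exp_first_two_terms[of y] by simp
  moreover have "exp (norm y) - 1 - norm y = suminf ?g"
    using exp_first_two_terms[of "norm y"] by simp
  ultimately show ?thesis
    using exp_bound[of "norm y"] assms by simp
qed

lemma exp_of_nat_scaleR:
  "exp (real n *\<^sub>R x) = exp (x :: 'a::{real_normed_algebra_1,banach}) ^ n"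
proof (induction n)
  case (Suc n)
  have "exp (real (Suc n) *\<^sub>R x) = exp (x + real n *\<^sub>R x)"
    by (simp add: scaleR_add_left)
  also have "\<dots> = exp x * exp (real n *\<^sub>R x)"
    by (rule exp_add_commuting) simp
  finally show ?case using Suc by simp
qed simp

text \<open>The error is at most the square of \<open>norm (X n)\<close> times
  \<open>1 / r n\<close>. The argument \<open>X n\<close> is allowed to vary for the sake of the
  closedness of \<open>lieCU\<close>.\<close>

lemma exp_difference_quotient:
  fixes x :: "'a::{real_normed_algebra_1,banach}"
  assumes x: "X \<longlonglongrightarrow> x" and r: "filterlim r at_top sequentially"
  shows "(\<lambda>n. r n *\<^sub>R (exp ((1 / r n) *\<^sub>R X n) - 1)) \<longlonglongrightarrow> x"
proof -
  have inv: "(\<lambda>n. 1 / r n) \<longlonglongrightarrow> 0"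
    using tendsto_inverse_0_at_top[OF r] by (simp add: inverse_eq_divide)
  have small: "(\<lambda>n. norm ((1 / r n) *\<^sub>R X n)) \<longlonglongrightarrow> 0"
    using tendsto_norm[OF tendsto_scaleR[OF inv x]] by simp
  have "(\<lambda>n. r n *\<^sub>R (exp ((1 / r n) *\<^sub>R X n) - 1) - X n) \<longlonglongrightarrow> 0"
  proof (rule tendsto_norm_zero_cancel, rule real_tendsto_sandwich[OF _ _ tendsto_const])
    show "(\<lambda>n. (norm (X n))\<^sup>2 * (1 / r n)) \<longlonglongrightarrow> 0"
      using tendsto_mult[OF tendsto_power[OF tendsto_norm[OF x]] inv] by simp
    show "\<forall>\<^sub>F n in sequentially. norm (r n *\<^sub>R (exp ((1 / r n) *\<^sub>R X n) - 1) - X n)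
        \<le> (norm (X n))\<^sup>2 * (1 / r n)"
      using order_tendstoD(2)[OF small zero_less_one] filterlim_at_top_dense[THEN iffD1, OF r, rule_format, of 0]
    proof eventually_elim
      case (elim n)
      have "r n *\<^sub>R (exp ((1 / r n) *\<^sub>R X n) - 1) - X n
          = r n *\<^sub>R (exp ((1 / r n) *\<^sub>R X n) - 1 - (1 / r n) *\<^sub>R X n)"
        using elim by (simp add: scaleR_diff_right)
      also have "norm \<dots> \<le> r n * (norm ((1 / r n) *\<^sub>R X n))\<^sup>2"
        using norm_exp_minus_linear[of "(1 / r n) *\<^sub>R X n"] elim by (simp add: mult_left_mono)
      also have "\<dots> = (norm (X n))\<^sup>2 * (1 / r n)"
        using elim by (simp add: power2_eq_square)
      finally show ?case .
    qed
  qed auto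
  from tendsto_add[OF this x] show ?thesis by simp
qed

lemma star_exp: "star (exp x) = exp (star (x::'a::cstar_algebra))"
  unfolding exp_def
  using bounded_linear.suminf[OF bounded_linear_star summable_exp_generic[of x]]
  by (simp add: star_power)

subsection \<open>The group of unitaries\<close>

lemma norm_unitary: "u \<in> unitaries \<Longrightarrow> norm (u::'a::cstar_algebra) = 1"
  using norm_star_mult_self[of u] norm_ge_zero[of u] by (auto simp: unitaries_def power2_eq_1_iff)

lemma one_in_unitaries: "1 \<in> (unitaries :: 'a::cstar_algebra set)"
  by (simp add: unitaries_def)

lemma unitaries_mult:
  assumes "u \<in> unitaries" "v \<in> unitaries"
  shows "u * v \<in> (unitaries :: 'a::cstar_algebra set)"
proof -
  have "star v * (star u * u) * v = 1" "u * (v * star v) * star u = 1"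
    using assms by (simp_all add: unitaries_def)
  then show ?thesis by (simp add: unitaries_def star_mult mult.assoc)
qed

lemma star_in_unitaries: "u \<in> unitaries \<Longrightarrow> star u \<in> (unitaries :: 'a::cstar_algebra set)"
  by (simp add: unitaries_def)

lemma closed_unitaries: "closed (unitaries :: 'a::cstar_algebra set)"
  unfolding unitaries_def
  by (intro closed_Collect_conj closed_Collect_eq continuous_intros)

lemma U0_subset_unitaries: "U0 \<subseteq> unitaries"
  unfolding U0_def by (rule connected_component_subset)

lemma one_in_U0: "1 \<in> (U0 :: 'a::cstar_algebra set)"
  by (simp add: U0_def one_in_unitaries)

lemma U0I:
  "connected T \<Longrightarrow> T \<subseteq> unitaries \<Longrightarrow> u \<in> T \<Longrightarrow> v \<in> T \<Longrightarrow> u \<in> U0 \<Longrightarrow> v \<in> U0"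
  unfolding U0_def by (simp, metis connected_component_def connected_component_trans)

lemma connected_U0: "connected U0"
  unfolding U0_def by (rule connected_connected_component)

lemma U0_mult:
  assumes "u \<in> U0" "v \<in> U0"
  shows "u * v \<in> (U0 :: 'a::cstar_algebra set)"
proof (rule U0I)
  show "connected ((*) u ` U0)"
    by (intro connected_continuous_image connected_U0 continuous_intros)
  show "(*) u ` U0 \<subseteq> unitaries"
    using assms U0_subset_unitaries unitaries_mult by blast
  show "u \<in> (*) u ` U0" using one_in_U0 by force
qed (use assms in auto)

lemma star_in_U0:
  assumes "u \<in> U0"
  shows "star u \<in> (U0 :: 'a::cstar_algebra set)"
proof (rule U0I)
  show "connected (star ` (U0::'a set))"
    by (intro connected_continuous_image connected_U0 continuous_intros)
  show "star ` (U0::'a set) \<subseteq> unitaries"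
    using U0_subset_unitaries star_in_unitaries by blast
  show "1 \<in> star ` (U0::'a set)" using one_in_U0 by force
qed (use assms one_in_U0 in auto)

lemma closed_U0: "closed (U0 :: 'a::cstar_algebra set)"
  unfolding U0_def by (intro closed_connected_component closed_unitaries)

lemma group_U0: "group (U0_group :: 'a::cstar_algebra monoid)"
proof (rule groupI)
  fix u :: 'a assume "u \<in> carrier U0_group"
  then have "star u \<in> U0" "star u * u = 1"
    using star_in_U0 U0_subset_unitaries by (auto simp: U0_group_def unitaries_def)
  then show "\<exists>v\<in>carrier U0_group. v \<otimes>\<^bsub>U0_group\<^esub> u = \<one>\<^bsub>U0_group\<^esub>"
    by (auto simp: U0_group_def)
qed (auto simp: U0_group_def U0_mult one_in_U0 mult.assoc)

lemma inv_U0_group: "u \<in> U0 \<Longrightarrow> inv\<^bsub>U0_group\<^esub> u = star (u::'a::cstar_algebra)"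
  using U0_subset_unitaries star_in_U0
  by (intro group.inv_equality[OF group_U0]) (auto simp: U0_group_def unitaries_def)

section \<open>The closed commutator subgroup \<open>CU\<close>\<close>

lemma CU_subset_U0: "CU \<subseteq> (U0 :: 'a::cstar_algebra set)"
proof -
  have "derived U0_group U0 \<subseteq> (U0 :: 'a set)"
    using group.derived_in_carrier[OF group_U0, of U0] by (simp add: U0_group_def)
  then show ?thesis
    unfolding CU_def by (rule closure_minimal[OF _ closed_U0])
qed

lemma closed_CU: "closed (CU :: 'a::cstar_algebra set)"
  by (simp add: CU_def)

lemma commutator_in_CU:
  fixes u v :: "'a::cstar_algebra"
  assumes "u \<in> U0" "v \<in> U0"
  shows "u * v * star u * star v \<in> CU"
proof -
  have "u \<otimes>\<^bsub>U0_group\<^esub> v \<otimes>\<^bsub>U0_group\<^esub> inv\<^bsub>U0_group\<^esub> u \<otimes>\<^bsub>U0_group\<^esub> inv\<^bsub>U0_group\<^esub> v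
      \<in> derived U0_group U0"
    unfolding derived_def using assms by (intro generate.incl) blast
  then have "u * v * star u * star v \<in> derived U0_group U0"
    using assms by (simp add: inv_U0_group) (simp add: U0_group_def)
  then show ?thesis unfolding CU_def using closure_subset by blast
qed

lemma one_in_CU: "1 \<in> (CU :: 'a::cstar_algebra set)"
  using commutator_in_CU[OF one_in_U0 one_in_U0] by simp

lemma CU_mult:
  fixes u v :: "'a::cstar_algebra"
  assumes "u \<in> CU" "v \<in> CU"
  shows "u * v \<in> CU"
proof -
  obtain X Y where X: "\<And>n. X n \<in> derived U0_group U0" "X \<longlonglongrightarrow> u"
    and Y: "\<And>n. Y n \<in> derived U0_group U0" "Y \<longlonglongrightarrow> v"
    using assms unfolding CU_def closure_sequential by blast
  have "X n \<otimes>\<^bsub>U0_group\<^esub> Y n \<in> derived U0_group U0" for n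
    using X(1) Y(1) unfolding derived_def by (rule generate.eng)
  then have "X n * Y n \<in> derived U0_group U0" for n
    by (simp add: U0_group_def)
  moreover have "(\<lambda>n. X n * Y n) \<longlonglongrightarrow> u * v"
    by (intro tendsto_mult X Y)
  ultimately show ?thesis
    unfolding CU_def closure_sequential by (intro exI[of _ "\<lambda>n. X n * Y n"]) auto
qed

lemma CU_power: "u \<in> CU \<Longrightarrow> u ^ n \<in> (CU :: 'a::cstar_algebra set)"
  by (induction n) (simp_all add: one_in_CU CU_mult)

section \<open>Exponentials of skew elements generate \<open>U0\<close>\<close>

lemma exp_skew_in_unitaries:
  fixes x :: "'a::cstar_algebra"
  assumes "star x = - x"
  shows "exp x \<in> unitaries"
  using exp_minus_inverse[of x] exp_minus_inverse[of "- x"] assms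
  by (simp add: unitaries_def star_exp)

lemma exp_skew_in_U0:
  fixes x :: "'a::cstar_algebra"
  assumes "star x = - x"
  shows "exp x \<in> U0"
proof (rule U0I)
  let ?T = "range (\<lambda>t. exp (t *\<^sub>R x))"
  have "continuous_on UNIV (\<lambda>t. exp (t *\<^sub>R x))"
    using exp_scaleR_has_vector_derivative_right has_vector_derivative_continuous
    by (fastforce intro!: continuous_at_imp_continuous_on)
  then show "connected ?T"
    by (rule connected_continuous_image) simp
  show "?T \<subseteq> unitaries"
    using assms by (auto intro!: exp_skew_in_unitaries)
  show "1 \<in> ?T" by (rule range_eqI[of _ _ 0]) simp
  show "exp x \<in> ?T" by (rule range_eqI[of _ _ 1]) simp
qed (rule one_in_U0)

text \<open>The remainder \<open>exp (- x) * u\<close>, with \<open>x\<close> the skew part of \<open>u\<close>, is much closer to \<open>1\<close> than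
  \<open>u\<close> is, so iterating writes \<open>u\<close> as a convergent product of exponentials.\<close>

lemma unitary_near_one_approx:
  fixes u :: "'a::cstar_algebra"
  assumes exps: "\<And>x::'a::cstar_algebra. star x = - x \<Longrightarrow> exp x \<in> CU"
  assumes "u \<in> unitaries" "norm (u - 1) \<le> 1/3"
  shows "\<exists>h\<in>CU. norm (u - h) \<le> (1/2) ^ k * norm (u - 1)"
  using assms(2,3)
proof (induction k arbitrary: u)
  case 0
  then show ?case by (intro bexI[of _ 1]) (auto simp: one_in_CU)
next
  case (Suc k)
  define x where "x = (1/2) *\<^sub>R (u - star u)"
  have x: "star x = - x" by (simp add: x_def star_diff algebra_simps)
  have "norm x \<le> (1/2) * (norm (u - 1) + norm (star (u - 1)))"
    using norm_triangle_ineq4[of "u - 1" "star (u - 1)"] by (simp add: x_def star_diff)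
  then have nx: "norm x \<le> norm (u - 1)" by (simp del: norm_star) simp
  \<comment> \<open>\<open>u - 1 - x\<close> is \<open>(1/2) *\<^sub>R (u + star u) - 1\<close>;
    unitarity expresses it through \<open>star (u - 1) * (u - 1)\<close>, so it is of second order
    in \<open>u - 1\<close>.\<close>
  have "star (u - 1) * (u - 1) = - (2 *\<^sub>R (u - 1 - x))"
    using Suc.prems(1) by (simp add: x_def unitaries_def star_diff algebra_simps scaleR_2)
  then have "norm (u - 1 - x) = (norm (u - 1))\<^sup>2 / 2"
    using norm_star_mult_self[of "u - 1"] by simp
  moreover have "norm (exp x - 1 - x) \<le> (norm (u - 1))\<^sup>2"
    using norm_exp_minus_linear[of x] nx Suc.prems(2) power_mono[OF nx norm_ge_zero, of 2] by linarith
  moreover have "u - exp x = (u - 1 - x) - (exp x - 1 - x)" by simp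
  ultimately have ux: "norm (u - exp x) \<le> 3/2 * (norm (u - 1))\<^sup>2"
    using norm_triangle_ineq4[of "u - 1 - x" "exp x - 1 - x"] by simp
  \<comment> \<open>The radius \<open>1/3\<close> is exactly what makes \<open>3/2 * d^2\<close> at
    most \<open>1/2 * d\<close> for \<open>d = norm (u - 1)\<close>.\<close>
  have d: "norm (u - exp x) \<le> 1/2 * norm (u - 1)"
  proof -
    have "norm (u - 1) * norm (u - 1) \<le> 1/3 * norm (u - 1)"
      using Suc.prems(2) by (intro mult_right_mono) auto
    with ux show ?thesis by (simp add: power2_eq_square)
  qed
  have e: "exp x * exp (- x) = 1" "exp (- x) * exp x = 1"
    using exp_minus_inverse[of x] exp_minus_inverse[of "- x"] by simp_all
  have sk: "star (- x) = - (- x)" using x by simp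
  have n1: "norm (exp x) = 1" "norm (exp (- x)) = 1"
    by (intro norm_unitary exp_skew_in_unitaries x sk)+
  define w where "w = exp (- x) * u"
  have "w - 1 = exp (- x) * (u - exp x)"
    by (simp add: w_def right_diff_distrib e)
  then have w1: "norm (w - 1) \<le> 1/2 * norm (u - 1)"
    using norm_mult_ineq[of "exp (- x)" "u - exp x"] d n1 by simp
  then have "norm (w - 1) \<le> 1/3" using Suc.prems(2) by simp
  moreover have "w \<in> unitaries"
    unfolding w_def by (intro unitaries_mult exp_skew_in_unitaries sk Suc.prems)
  ultimately obtain h where h: "h \<in> CU" "norm (w - h) \<le> (1/2) ^ k * norm (w - 1)"
    using Suc.IH by blast
  have "u - exp x * h = exp x * (w - h)"
    by (simp add: w_def right_diff_distrib e flip: mult.assoc)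
  then have "norm (u - exp x * h) \<le> norm (w - h)"
    using norm_mult_ineq[of "exp x" "w - h"] n1 by simp
  also have "\<dots> \<le> (1/2) ^ k * (1/2 * norm (u - 1))"
    using h(2) w1 by (meson mult_left_mono order_trans zero_le_power half_gt_zero zero_le_one zero_le_divide_1_iff zero_le_numeral)
  finally show ?case
    using h(1) exps[OF x] by (intro bexI[of _ "exp x * h"] CU_mult) auto
qed

text \<open>\<open>U0 \<inter> CU\<close> is relatively closed in \<open>U0\<close>, and open
  because unitaries within \<open>1/3\<close> of \<open>1\<close> lie in \<open>CU\<close>, a fact
  carried to any \<open>h\<close> by left multiplication. Connectedness of \<open>U0\<close> does
  the rest.\<close>

lemma U0_subset_CU:
  assumes exps: "\<And>x::'a::cstar_algebra. star x = - x \<Longrightarrow> exp x \<in> CU"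
  shows "U0 \<subseteq> (CU :: 'a::cstar_algebra set)"
proof -
  have near: "u \<in> CU" if "u \<in> unitaries" "norm (u - 1) \<le> 1/3" for u :: 'a
  proof -
    have "\<exists>h\<in>CU. dist h u < e" if "e > 0" for e
    proof -
      obtain k where "(1/2 :: real) ^ k < e"
        using real_arch_pow_inv[OF \<open>e > 0\<close>, of "1/2"] by auto
      moreover obtain h where "h \<in> CU" "norm (u - h) \<le> (1/2) ^ k * norm (u - 1)"
        using unitary_near_one_approx[OF _ \<open>u \<in> unitaries\<close> \<open>norm (u - 1) \<le> 1/3\<close>, of k] exps by blast
      moreover have "(1/2) ^ k * norm (u - 1) \<le> (1/2) ^ k"
        using \<open>norm (u - 1) \<le> 1/3\<close> by (simp add: mult_left_le)
      ultimately have "norm (u - h) < e" by linarith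
      with \<open>h \<in> CU\<close> show ?thesis by (auto simp: dist_norm norm_minus_commute)
    qed
    then have "u \<in> closure CU" by (simp add: closure_approachable)
    then show ?thesis by (simp add: closed_CU)
  qed
  have "openin (top_of_set U0) (U0 \<inter> CU :: 'a set)"
    unfolding openin_contains_ball
  proof (intro conjI ballI)
    fix h :: 'a assume h: "h \<in> U0 \<inter> CU"
    then have hu: "h \<in> unitaries" using U0_subset_unitaries by blast
    have "u \<in> CU" if u: "u \<in> U0" "dist h u < 1/3" for u
    proof -
      have uu: "u \<in> unitaries" using u U0_subset_unitaries by blast
      have "star h * u - 1 = star h * (u - h)"
        using hu by (simp add: unitaries_def right_diff_distrib)
      then have "norm (star h * u - 1) \<le> norm (star h) * norm (u - h)"
        by (metis norm_mult_ineq)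
      also have "\<dots> \<le> 1/3"
        using u norm_unitary[OF hu] by (simp add: dist_norm norm_minus_commute)
      finally have "star h * u \<in> CU"
        using hu uu by (intro near unitaries_mult star_in_unitaries)
      then have "h * (star h * u) \<in> CU" using h by (blast intro: CU_mult)
      moreover have "h * (star h * u) = u"
        using hu by (simp add: unitaries_def flip: mult.assoc)
      ultimately show ?thesis by simp
    qed
    then show "\<exists>e>0. ball h e \<inter> U0 \<subseteq> U0 \<inter> CU"
      by (intro exI[of _ "1/3"]) auto
  qed simp
  moreover have "closedin (top_of_set U0) (U0 \<inter> CU :: 'a set)"
    by (intro closedin_closed_Int closed_CU)
  ultimately have "U0 \<inter> CU = ({} :: 'a set) \<or> U0 \<inter> CU = (U0 :: 'a set)"
    using connected_U0 unfolding connected_clopen by blast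
  then show ?thesis using one_in_U0 one_in_CU by blast
qed

subsection \<open>One-parameter subgroups inside \<open>CU\<close>\<close>

lemma norm_power_diff_le:
  fixes u v :: "'a::real_normed_algebra_1"
  assumes "norm u \<le> 1" "norm v \<le> 1"
  shows "norm (u ^ n - v ^ n) \<le> real n * norm (u - v)"
proof (induction n)
  case (Suc n)
  have "u ^ Suc n - v ^ Suc n = u * (u ^ n - v ^ n) + (u - v) * v ^ n"
    by (simp add: algebra_simps)
  also have "norm \<dots> \<le> norm u * norm (u ^ n - v ^ n) + norm (u - v) * norm v ^ n"
    by (meson add_mono norm_mult_ineq norm_triangle_ineq order_trans mult_left_mono
        norm_ge_zero norm_power_ineq)
  also have "\<dots> \<le> 1 * norm (u ^ n - v ^ n) + norm (u - v) * 1"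
    using assms by (intro add_mono mult_right_mono mult_left_mono power_le_one) auto
  finally show ?case using Suc by (simp add: algebra_simps)
qed simp

text \<open>\<open>u n\<close> and \<open>v n = exp ((1 / k n) *\<^sub>R x)\<close> have the same
  difference quotient, and \<open>norm_power_diff_le\<close> loses only a factor \<open>k n\<close>
  when passing to powers. Thus \<open>u n ^ k n\<close> tends to \<open>exp x\<close>, and
  \<open>CU\<close> is closed under powers and limits.\<close>

lemma exp_in_CU_if_difference_quotient:
  fixes x :: "'a::cstar_algebra"
  assumes u: "\<And>n. u n \<in> CU" and x: "star x = - x"
    and k: "filterlim k at_top sequentially"
    and lim: "(\<lambda>n. real (k n) *\<^sub>R (u n - 1)) \<longlonglongrightarrow> x"
  shows "exp x \<in> CU"
proof -
  define v where "v n = exp ((1 / real (k n)) *\<^sub>R x)" for n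
  have rk: "filterlim (\<lambda>n. real (k n)) at_top sequentially"
    by (rule filterlim_compose[OF filterlim_real_sequentially k])
  have "(\<lambda>n. real (k n) *\<^sub>R (v n - 1)) \<longlonglongrightarrow> x"
    unfolding v_def by (rule exp_difference_quotient[OF tendsto_const rk])
  from tendsto_diff[OF lim this]
  have "(\<lambda>n. norm (real (k n) *\<^sub>R (u n - v n))) \<longlonglongrightarrow> 0"
    by (intro tendsto_norm_zero) (simp flip: scaleR_diff_right)
  then have "(\<lambda>n. u n ^ k n - v n ^ k n) \<longlonglongrightarrow> 0"
  proof (rule tendsto_0_le[where K = 1, OF _ always_eventually, rule_format])
    fix n
    have "norm (u n) \<le> 1" "norm (v n) \<le> 1"
      using u CU_subset_U0 U0_subset_unitaries norm_unitary[of "u n"] x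
        norm_unitary[OF exp_skew_in_unitaries, of "(1 / real (k n)) *\<^sub>R x"]
      by (force simp: v_def)+
    then show "norm (u n ^ k n - v n ^ k n) \<le> norm (norm (real (k n) *\<^sub>R (u n - v n))) * 1"
      using norm_power_diff_le[of "u n" "v n" "k n"] by simp
  qed
  \<comment> \<open>The identity \<open>v n ^ k n = exp x\<close> requires
    \<open>k n \<ge> 1\<close>; for \<open>k n = 0\<close> division by zero makes
    \<open>v n = 1\<close>.\<close>
  moreover have "\<forall>\<^sub>F n in sequentially. u n ^ k n - v n ^ k n = u n ^ k n - exp x"
    using k[unfolded filterlim_at_top, rule_format, of 1]
    by eventually_elim (simp add: v_def flip: exp_of_nat_scaleR)
  ultimately have "(\<lambda>n. u n ^ k n - exp x) \<longlonglongrightarrow> 0"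
    by (rule Lim_transform_eventually)
  then have "(\<lambda>n. u n ^ k n) \<longlonglongrightarrow> exp x" by (simp add: LIM_zero_iff)
  then show ?thesis
    by (rule closed_sequentially[OF closed_CU, rotated]) (intro CU_power u)
qed

definition lieCU :: "'a::cstar_algebra set" where
  "lieCU = {x. star x = - x \<and> (\<forall>t. exp (t *\<^sub>R x) \<in> CU)}"

lemma lieCU_skew: "x \<in> lieCU \<Longrightarrow> star x = - x"
  by (simp add: lieCU_def)

lemma exp_in_CU: "x \<in> lieCU \<Longrightarrow> exp (t *\<^sub>R x) \<in> CU"
  by (simp add: lieCU_def)

lemma lieCU_scaleR: "x \<in> lieCU \<Longrightarrow> r *\<^sub>R x \<in> lieCU"
  by (simp add: lieCU_def)

text \<open>One rate \<open>k\<close> serves every \<open>t\<close>. The sequences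
  \<open>u t\<close> will be Trotter products, exponentials of approximating elements, and group
  commutators.\<close>

lemma lieCUI:
  fixes x :: "'a::cstar_algebra"
  assumes "star x = - x"
    and "\<And>t n. u t n \<in> CU"
    and "filterlim k at_top sequentially"
    and "\<And>t. (\<lambda>n. real (k n) *\<^sub>R (u t n - 1)) \<longlonglongrightarrow> t *\<^sub>R x"
  shows "x \<in> lieCU"
proof -
  have "exp (t *\<^sub>R x) \<in> CU" for t
    by (rule exp_in_CU_if_difference_quotient[where u = "u t" and k = k]) (use assms in auto)
  with assms(1) show ?thesis by (simp add: lieCU_def)
qed

lemma exp_tendsto_one:
  fixes x :: "'a::{real_normed_algebra_1,banach}"
  shows "(\<lambda>n. exp ((1 / real n) *\<^sub>R x)) \<longlonglongrightarrow> 1"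
proof -
  have "(\<lambda>n. (1 / real n) *\<^sub>R (real n *\<^sub>R (exp ((1 / real n) *\<^sub>R x) - 1))) \<longlonglongrightarrow> 0 *\<^sub>R x"
    by (intro tendsto_scaleR lim_1_over_n exp_difference_quotient[OF tendsto_const filterlim_real_sequentially])
  moreover have "\<forall>\<^sub>F n in sequentially. (1 / real n) *\<^sub>R (real n *\<^sub>R (exp ((1 / real n) *\<^sub>R x) - 1))
      = exp ((1 / real n) *\<^sub>R x) - 1"
    by (rule eventually_sequentiallyI[of 1]) simp
  ultimately have "(\<lambda>n. exp ((1 / real n) *\<^sub>R x) - 1) \<longlonglongrightarrow> 0 *\<^sub>R x"
    by (rule Lim_transform_eventually)
  then show ?thesis by (simp add: LIM_zero_iff)
qed

lemma lieCU_add: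
  fixes x y :: "'a::cstar_algebra"
  assumes "x \<in> lieCU" "y \<in> lieCU"
  shows "x + y \<in> lieCU"
proof (rule lieCUI)
  let ?e = "\<lambda>x n. exp ((1 / real n) *\<^sub>R (x::'a))"
  show "?e (t *\<^sub>R x) n * ?e (t *\<^sub>R y) n \<in> CU" for t n
    using assms by (intro CU_mult exp_in_CU lieCU_scaleR)
  show "star (x + y) = - (x + y)" using assms by (simp add: lieCU_skew star_add)
  have ex: "(\<lambda>n. real n *\<^sub>R (?e z n - 1)) \<longlonglongrightarrow> z" for z
    by (rule exp_difference_quotient[OF tendsto_const filterlim_real_sequentially])
  fix t
  \<comment> \<open>From \<open>a * b - 1 = (a - 1) * b + (b - 1)\<close>, the quotient of the
    product splits into the quotients of the factors.\<close>
  have "(\<lambda>n. real n *\<^sub>R (?e (t *\<^sub>R x) n - 1) * ?e (t *\<^sub>R y) n + real n *\<^sub>R (?e (t *\<^sub>R y) n - 1))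
      \<longlonglongrightarrow> (t *\<^sub>R x) * 1 + t *\<^sub>R y"
    by (intro tendsto_add tendsto_mult ex exp_tendsto_one)
  moreover have "real n *\<^sub>R (?e (t *\<^sub>R x) n - 1) * ?e (t *\<^sub>R y) n + real n *\<^sub>R (?e (t *\<^sub>R y) n - 1)
      = real n *\<^sub>R (?e (t *\<^sub>R x) n * ?e (t *\<^sub>R y) n - 1)" for n
    by (simp add: left_diff_distrib scaleR_diff_right)
  ultimately show "(\<lambda>n. real n *\<^sub>R (?e (t *\<^sub>R x) n * ?e (t *\<^sub>R y) n - 1)) \<longlonglongrightarrow> t *\<^sub>R (x + y)"
    by (simp only: mult_1_right scaleR_add_right)
qed (rule filterlim_ident)

lemma closed_lieCU: "closed (lieCU :: 'a::cstar_algebra set)"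
  unfolding closed_sequential_limits
proof (intro allI impI)
  fix X and x :: 'a
  assume "(\<forall>n. X n \<in> lieCU) \<and> X \<longlonglongrightarrow> x"
  then have X: "\<And>n. X n \<in> lieCU" and lim: "X \<longlonglongrightarrow> x" by auto
  show "x \<in> lieCU"
  proof (rule lieCUI)
    show "exp ((1 / real n) *\<^sub>R (t *\<^sub>R X n)) \<in> CU" for t n
      using X by (intro exp_in_CU lieCU_scaleR)
    have "(\<lambda>n. star (X n)) \<longlonglongrightarrow> star x"
      by (rule bounded_linear.tendsto[OF bounded_linear_star lim])
    moreover have "(\<lambda>n. star (X n)) \<longlonglongrightarrow> - x"
      using tendsto_minus[OF lim] by (simp add: lieCU_skew[OF X])
    ultimately show "star x = - x" by (rule LIMSEQ_unique)
    show "(\<lambda>n. real n *\<^sub>R (exp ((1 / real n) *\<^sub>R (t *\<^sub>R X n)) - 1)) \<longlonglongrightarrow> t *\<^sub>R x" for t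
      by (intro exp_difference_quotient tendsto_scaleR tendsto_const lim filterlim_real_sequentially)
  qed (rule filterlim_ident)
qed

lemma commutator_in_lieCU:
  fixes x y :: "'a::cstar_algebra"
  assumes x: "star x = - x" and y: "star y = - y"
  shows "x * y - y * x \<in> lieCU"
proof (rule lieCUI)
  let ?e = "\<lambda>x n. exp ((1 / real n) *\<^sub>R (x::'a))"
  show "star (x * y - y * x) = - (x * y - y * x)"
    by (simp add: star_diff star_mult x y)
  have U: "?e (t *\<^sub>R x) n \<in> U0" "?e y n \<in> U0" for t n
    by (intro exp_skew_in_U0; simp add: x y)+
  then show "?e (t *\<^sub>R x) n * ?e y n * star (?e (t *\<^sub>R x) n) * star (?e y n) \<in> CU" for t n
    by (intro commutator_in_CU)
  show "filterlim (\<lambda>n. n * n) at_top sequentially"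
    by (rule filterlim_at_top_mono[OF filterlim_ident]) simp
  fix t
  let ?a = "?e (t *\<^sub>R x)" and ?b = "?e y"
  have ex: "(\<lambda>n. real n *\<^sub>R (?e z n - 1)) \<longlonglongrightarrow> z" for z
    by (rule exp_difference_quotient[OF tendsto_const filterlim_real_sequentially])
  have s1: "(\<lambda>n. star (?e z n)) \<longlonglongrightarrow> star 1" for z
    by (intro bounded_linear.tendsto[OF bounded_linear_star] exp_tendsto_one)
  have "real (n * n) *\<^sub>R (?a n * ?b n * star (?a n) * star (?b n) - 1)
      = ((real n *\<^sub>R (?a n - 1)) * (real n *\<^sub>R (?b n - 1))
          - (real n *\<^sub>R (?b n - 1)) * (real n *\<^sub>R (?a n - 1))) * (star (?a n) * star (?b n))" for n
  proof -
    have "?a n * star (?a n) = 1" "?b n * star (?b n) = 1"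
      using subsetD[OF U0_subset_unitaries U(1)[of n t]] subsetD[OF U0_subset_unitaries U(2)[of n]]
      by (simp_all add: unitaries_def)
    then have "?b n * (?a n * star (?a n)) * star (?b n) = 1" by simp
    then have "?a n * ?b n * star (?a n) * star (?b n) - 1
        = (?a n * ?b n - ?b n * ?a n) * (star (?a n) * star (?b n))"
      by (simp add: left_diff_distrib mult.assoc)
    also have "?a n * ?b n - ?b n * ?a n = (?a n - 1) * (?b n - 1) - (?b n - 1) * (?a n - 1)"
      by (simp add: algebra_simps)
    finally show ?thesis
      by (simp only: scaleR_scaleR mult_scaleR_left mult_scaleR_right of_nat_mult)
        (simp flip: scaleR_diff_right)
  qed
  moreover have "(\<lambda>n. ((real n *\<^sub>R (?a n - 1)) * (real n *\<^sub>R (?b n - 1))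
          - (real n *\<^sub>R (?b n - 1)) * (real n *\<^sub>R (?a n - 1))) * (star (?a n) * star (?b n)))
      \<longlonglongrightarrow> ((t *\<^sub>R x) * y - y * (t *\<^sub>R x)) * (star 1 * star 1)"
    by (intro tendsto_mult tendsto_diff ex s1)
  moreover have "((t *\<^sub>R x) * y - y * (t *\<^sub>R x)) * (star 1 * star 1) = t *\<^sub>R (x * y - y * x)"
    by (simp add: scaleR_diff_right)
  ultimately show "(\<lambda>n. real (n * n) *\<^sub>R (?a n * ?b n * star (?a n) * star (?b n) - 1))
      \<longlonglongrightarrow> t *\<^sub>R (x * y - y * x)"
    by simp
qed

subsection \<open>Positive functionals\<close>

text \<open>The Zorn step of an algebraic Hahn-Banach argument. If a maximal cone rejected both
  \<open>x\<close> and \<open>- x\<close>, each of the two enlarged cones would contain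
  \<open>- e\<close>, and a positive combination of these facts would put \<open>- e\<close> into
  the cone itself.\<close>

lemma maximal_cone_total:
  fixes K :: "'b::real_vector set"
  assumes "0 \<in> K"
    and add: "\<And>x y. x \<in> K \<Longrightarrow> y \<in> K \<Longrightarrow> x + y \<in> K"
    and scale: "\<And>r x. 0 \<le> r \<Longrightarrow> x \<in> K \<Longrightarrow> r *\<^sub>R x \<in> K"
    and "- e \<notin> K"
  obtains C where "K \<subseteq> C" "\<And>x y. x \<in> C \<Longrightarrow> y \<in> C \<Longrightarrow> x + y \<in> C"
    "\<And>r x. 0 \<le> r \<Longrightarrow> x \<in> C \<Longrightarrow> r *\<^sub>R x \<in> C" "- e \<notin> C" "\<And>x. x \<in> C \<or> - x \<in> C"
proof -
  define \<A> where "\<A> = {C. K \<subseteq> C \<and> (\<forall>x\<in>C. \<forall>y\<in>C. x + y \<in> C) \<and>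
      (\<forall>r\<ge>0. \<forall>x\<in>C. r *\<^sub>R x \<in> C) \<and> - e \<notin> C}"
  have "K \<in> \<A>" using assms by (auto simp: \<A>_def)
  have "\<Union>\<C> \<in> \<A>" if "\<C> \<noteq> {}" "subset.chain \<A> \<C>" for \<C>
  proof -
    have mem: "\<And>C. C \<in> \<C> \<Longrightarrow> C \<in> \<A>" and tot: "\<And>C D. C \<in> \<C> \<Longrightarrow> D \<in> \<C> \<Longrightarrow> C \<subseteq> D \<or> D \<subseteq> C"
      using that(2) by (auto simp: subset_chain_def)
    have "x + y \<in> \<Union>\<C>" if "x \<in> C" "C \<in> \<C>" "y \<in> D" "D \<in> \<C>" for x y C D
    proof -
      obtain E where "E \<in> \<C>" "x \<in> E" "y \<in> E" using tot[of C D] \<open>x \<in> C\<close> \<open>C \<in> \<C>\<close> \<open>y \<in> D\<close> \<open>D \<in> \<C>\<close> by blast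
      with mem[of E] show ?thesis unfolding \<A>_def by auto
    qed
    then have "\<forall>x\<in>\<Union>\<C>. \<forall>y\<in>\<Union>\<C>. x + y \<in> \<Union>\<C>" by blast
    moreover have "\<forall>r\<ge>0. \<forall>x\<in>\<Union>\<C>. r *\<^sub>R x \<in> \<Union>\<C>" "- e \<notin> \<Union>\<C>"
      using mem unfolding \<A>_def by auto
    moreover have "K \<subseteq> \<Union>\<C>" using \<open>\<C> \<noteq> {}\<close> mem unfolding \<A>_def by blast
    ultimately show ?thesis unfolding \<A>_def by simp
  qed
  then obtain C where C: "C \<in> \<A>" and max: "\<And>D. D \<in> \<A> \<Longrightarrow> C \<subseteq> D \<Longrightarrow> D = C"
    using subset_Zorn_nonempty[of \<A>] \<open>K \<in> \<A>\<close> by blast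
  have Cadd: "\<And>x y. x \<in> C \<Longrightarrow> y \<in> C \<Longrightarrow> x + y \<in> C"
    and Cscale: "\<And>r x. 0 \<le> r \<Longrightarrow> x \<in> C \<Longrightarrow> r *\<^sub>R x \<in> C"
    and Ce: "- e \<notin> C" and KC: "K \<subseteq> C"
    using C by (auto simp: \<A>_def)
  have ext: "\<exists>c\<in>C. \<exists>t>0. - e = c + t *\<^sub>R x" if x: "x \<notin> C" for x
  proof -
    define D where "D = {c + t *\<^sub>R x | c t. c \<in> C \<and> 0 \<le> t}"
    have "c + 0 *\<^sub>R x \<in> D" if "c \<in> C" for c
      using that unfolding D_def by blast
    then have "C \<subseteq> D" by auto
    have "0 + 1 *\<^sub>R x \<in> D"
      using KC \<open>0 \<in> K\<close> unfolding D_def by (intro CollectI exI[of _ 0] exI[of _ 1]) auto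
    then have "D \<noteq> C" using x by auto
    then have "D \<notin> \<A>" using max \<open>C \<subseteq> D\<close> by blast
    moreover have "a + b \<in> D" if "a \<in> D" "b \<in> D" for a b
    proof -
      obtain c t c' t' where "a = c + t *\<^sub>R x" "b = c' + t' *\<^sub>R x" "c \<in> C" "c' \<in> C" "0 \<le> t" "0 \<le> t'"
        using \<open>a \<in> D\<close> \<open>b \<in> D\<close> unfolding D_def by blast
      then have "a + b = (c + c') + (t + t') *\<^sub>R x" "c + c' \<in> C" "0 \<le> t + t'"
        by (auto simp: algebra_simps Cadd)
      then show ?thesis unfolding D_def by blast
    qed
    moreover have "r *\<^sub>R a \<in> D" if "a \<in> D" "0 \<le> r" for a r
    proof -
      obtain c t where "a = c + t *\<^sub>R x" "c \<in> C" "0 \<le> t"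
        using \<open>a \<in> D\<close> unfolding D_def by blast
      then have "r *\<^sub>R a = r *\<^sub>R c + (r * t) *\<^sub>R x" "r *\<^sub>R c \<in> C" "0 \<le> r * t"
        using that(2) by (auto simp: algebra_simps Cscale)
      then show ?thesis unfolding D_def by blast
    qed
    ultimately have "- e \<in> D"
      using KC \<open>C \<subseteq> D\<close> unfolding \<A>_def by blast
    then obtain c t where "- e = c + t *\<^sub>R x" "c \<in> C" "0 \<le> t"
      unfolding D_def by blast
    moreover then have "t \<noteq> 0" using Ce by auto
    ultimately show ?thesis by (intro bexI[of _ c] exI[of _ t]) auto
  qed
  have "x \<in> C \<or> - x \<in> C" for x
  proof (rule ccontr)
    assume "\<not> (x \<in> C \<or> - x \<in> C)"
    then obtain c t d s where 1: "- e = c + t *\<^sub>R x" "c \<in> C" "0 < t"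
      and 2: "- e = d + s *\<^sub>R (- x)" "d \<in> C" "0 < s"
      using ext[of x] ext[of "- x"] by blast
    \<comment> \<open>The weights \<open>s\<close> and \<open>t\<close> are chosen to cancel
      \<open>x\<close>.\<close>
    have "s *\<^sub>R (- e) + t *\<^sub>R (- e) = s *\<^sub>R (c + t *\<^sub>R x) + t *\<^sub>R (d + s *\<^sub>R (- x))"
      using 1 2 by metis
    also have "\<dots> = s *\<^sub>R c + t *\<^sub>R d" by (simp add: algebra_simps)
    also have "\<dots> \<in> C" using 1 2 by (intro Cadd Cscale) auto
    finally have "(1 / (s + t)) *\<^sub>R (s *\<^sub>R (- e) + t *\<^sub>R (- e)) \<in> C"
      using 1 2 by (intro Cscale) auto
    moreover have "s *\<^sub>R (- e) + t *\<^sub>R (- e) = (s + t) *\<^sub>R (- e)" by (simp add: algebra_simps)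
    ultimately show False using Ce 1 2 by simp
  qed
  then show thesis using that KC Cadd Cscale Ce by blast
qed

text \<open>A total cone gives a total preorder, in which each \<open>x\<close> cuts the line
  spanned by \<open>e\<close>; \<open>f x\<close> is the position of the cut, and the order unit
  keeps it finite.\<close>

lemma order_unit_functional:
  fixes K :: "'b::real_vector set"
  assumes K: "0 \<in> K"
      "\<And>x y. x \<in> K \<Longrightarrow> y \<in> K \<Longrightarrow> x + y \<in> K"
      "\<And>r x. 0 \<le> r \<Longrightarrow> x \<in> K \<Longrightarrow> r *\<^sub>R x \<in> K"
    and unit: "\<And>x. \<exists>t. t *\<^sub>R e - x \<in> K"
    and "- e \<notin> K"
  obtains f :: "'b \<Rightarrow> real" where "linear f" "f e = 1" "\<And>x. x \<in> K \<Longrightarrow> 0 \<le> f x"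
proof -
  obtain C where KC: "K \<subseteq> C" and add: "\<And>x y. x \<in> C \<Longrightarrow> y \<in> C \<Longrightarrow> x + y \<in> C"
    and scale: "\<And>r x. 0 \<le> r \<Longrightarrow> x \<in> C \<Longrightarrow> r *\<^sub>R x \<in> C" and e: "- e \<notin> C"
    and total: "\<And>x. x \<in> C \<or> - x \<in> C"
    using maximal_cone_total[OF K \<open>- e \<notin> K\<close>] by blast
  have eC: "e \<in> C" using total[of e] e by auto
  have neg: "0 \<le> t" if "t *\<^sub>R e \<in> C" for t
  proof (rule ccontr)
    assume "\<not> 0 \<le> t"
    then have "(1 / (- t)) *\<^sub>R (t *\<^sub>R e) \<in> C" using that by (intro scale[of "1 / (- t)"]) auto
    with \<open>\<not> 0 \<le> t\<close> e show False by simp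
  qed
  \<comment> \<open>\<open>C\<close> carries no closedness, so the value is pinned down from both
    sides only up to each \<open>\<epsilon> > 0\<close>. Uniqueness of such \<open>r\<close> then
    yields every algebraic rule through \<open>fI\<close>.\<close>
  define F where "F x r \<longleftrightarrow> (\<forall>\<epsilon>>0. (r + \<epsilon>) *\<^sub>R e - x \<in> C \<and> x - (r - \<epsilon>) *\<^sub>R e \<in> C)" for x r
  have unique: "r = s" if "F x r" "F x s" for x r s
  proof -
    have "s \<le> r" if "F x r" "F x s" for r s
    proof (rule field_le_epsilon)
      fix \<epsilon> :: real assume "0 < \<epsilon>"
      then have "((r + \<epsilon>/2) *\<^sub>R e - x) + (x - (s - \<epsilon>/2) *\<^sub>R e) \<in> C"
        using that unfolding F_def by (intro add) (meson half_gt_zero)+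
      then have "(r + \<epsilon> - s) *\<^sub>R e \<in> C" by (simp add: algebra_simps flip: scaleR_add_left)
      then show "s \<le> r + \<epsilon>" using neg by fastforce
    qed
    with that show ?thesis by (meson antisym)
  qed
  have exist: "\<exists>r. F x r" for x
  proof -
    define T where "T = {t. t *\<^sub>R e - x \<in> C}"
    have "T \<noteq> {}" using unit[of x] KC by (auto simp: T_def)
    obtain s where s: "s *\<^sub>R e + x \<in> C" using unit[of "- x"] KC by auto
    have bdd: "bdd_below T"
    proof (rule bdd_belowI)
      fix t assume "t \<in> T"
      then have "(t *\<^sub>R e - x) + (s *\<^sub>R e + x) \<in> C" using s add unfolding T_def by blast
      then have "(t + s) *\<^sub>R e \<in> C" by (simp add: algebra_simps)
      then show "- s \<le> t" using neg by fastforce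
    qed
    have "F x (Inf T)"
      unfolding F_def
    proof (intro allI impI conjI)
      fix \<epsilon> :: real assume \<epsilon>: "0 < \<epsilon>"
      obtain t where t: "t \<in> T" "t < Inf T + \<epsilon>"
        using cInf_lessD[OF \<open>T \<noteq> {}\<close>, of "Inf T + \<epsilon>"] \<epsilon> by auto
      then have "(t *\<^sub>R e - x) + (Inf T + \<epsilon> - t) *\<^sub>R e \<in> C"
        using eC by (intro add[OF _ scale]) (auto simp: T_def)
      then show "(Inf T + \<epsilon>) *\<^sub>R e - x \<in> C" by (simp add: algebra_simps)
      \<comment> \<open>Totality enters here: a multiple of \<open>e\<close> that is not above
        \<open>x\<close> is below it.\<close>
      have "Inf T - \<epsilon> \<notin> T" using cInf_lower[OF _ bdd] \<epsilon> by force
      then have "- ((Inf T - \<epsilon>) *\<^sub>R e - x) \<in> C" using total unfolding T_def by blast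
      then show "x - (Inf T - \<epsilon>) *\<^sub>R e \<in> C" by simp
    qed
    then show ?thesis by blast
  qed
  define f where "f x = (THE r. F x r)" for x
  have f: "F x (f x)" for x
    unfolding f_def using exist unique by (metis theI')
  have fI: "f x = r" if "F x r" for x r
    using unique f that by blast
  have "linear f"
  proof
    show "f (x + y) = f x + f y" for x y
    proof (rule fI, unfold F_def, intro allI impI conjI)
      fix \<epsilon> :: real assume "0 < \<epsilon>"
      then have h: "0 < \<epsilon>/2" by simp
      have "((f x + \<epsilon>/2) *\<^sub>R e - x) + ((f y + \<epsilon>/2) *\<^sub>R e - y) \<in> C"
        using f h unfolding F_def by (intro add) blast+
      moreover have "((f x + \<epsilon>/2) *\<^sub>R e - x) + ((f y + \<epsilon>/2) *\<^sub>R e - y)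
          = ((f x + \<epsilon>/2) + (f y + \<epsilon>/2)) *\<^sub>R e - (x + y)"
        by (simp only: scaleR_add_left) simp
      ultimately show "(f x + f y + \<epsilon>) *\<^sub>R e - (x + y) \<in> C"
        by (simp add: algebra_simps)
      have "(x - (f x - \<epsilon>/2) *\<^sub>R e) + (y - (f y - \<epsilon>/2) *\<^sub>R e) \<in> C"
        using f h unfolding F_def by (intro add) blast+
      moreover have "(x - (f x - \<epsilon>/2) *\<^sub>R e) + (y - (f y - \<epsilon>/2) *\<^sub>R e)
          = (x + y) - ((f x - \<epsilon>/2) + (f y - \<epsilon>/2)) *\<^sub>R e"
        by (simp only: scaleR_add_left) simp
      ultimately show "x + y - (f x + f y - \<epsilon>) *\<^sub>R e \<in> C"
        by (simp add: algebra_simps)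
    qed
  next
    have pos: "f (r *\<^sub>R x) = r * f x" if r: "0 < r" for r x
    proof (rule fI, unfold F_def, intro allI impI conjI)
      fix \<epsilon> :: real assume "0 < \<epsilon>"
      then have h: "0 < \<epsilon>/r" using r by simp
      have "r *\<^sub>R ((f x + \<epsilon>/r) *\<^sub>R e - x) \<in> C" "r *\<^sub>R (x - (f x - \<epsilon>/r) *\<^sub>R e) \<in> C"
        using f h r unfolding F_def by (auto intro!: scale)
      then show "(r * f x + \<epsilon>) *\<^sub>R e - r *\<^sub>R x \<in> C" "r *\<^sub>R x - (r * f x - \<epsilon>) *\<^sub>R e \<in> C"
        using r by (simp_all add: scaleR_diff_right distrib_left right_diff_distrib)
    qed
    have minus: "f (- x) = - f x" for x
    proof (rule fI, unfold F_def, intro allI impI conjI)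
      fix \<epsilon> :: real assume "0 < \<epsilon>"
      then have "(f x + \<epsilon>) *\<^sub>R e - x \<in> C" "x - (f x - \<epsilon>) *\<^sub>R e \<in> C"
        using f unfolding F_def by blast+
      then show "(- f x + \<epsilon>) *\<^sub>R e - - x \<in> C" "- x - (- f x - \<epsilon>) *\<^sub>R e \<in> C"
        by (simp_all add: algebra_simps)
    qed
    have zero: "f 0 = 0" using minus[of 0] by simp
    show "f (r *\<^sub>R x) = r *\<^sub>R f x" for r x
    proof (cases r "0::real" rule: linorder_cases)
      case less
      then show ?thesis using pos[of "- r" x] minus[of "(- r) *\<^sub>R x"] by simp
    qed (use pos zero in auto)
  qed
  moreover have "f e = 1"
  proof (rule fI, unfold F_def, intro allI impI conjI)
    fix \<epsilon> :: real assume "0 < \<epsilon>"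
    then have "\<epsilon> *\<^sub>R e \<in> C" using eC by (intro scale) auto
    then show "(1 + \<epsilon>) *\<^sub>R e - e \<in> C" "e - (1 - \<epsilon>) *\<^sub>R e \<in> C"
      by (simp_all add: algebra_simps)
  qed
  moreover have "0 \<le> f x" if "x \<in> K" for x
  proof (rule field_le_epsilon)
    fix \<epsilon> :: real assume "0 < \<epsilon>"
    then have "(f x + \<epsilon>) *\<^sub>R e - x \<in> C" using f unfolding F_def by blast
    then have "((f x + \<epsilon>) *\<^sub>R e - x) + x \<in> C" using that KC add by blast
    then show "0 \<le> f x + \<epsilon>" using neg by simp
  qed
  ultimately show thesis using that by blast
qed

subsection \<open>Algebras without tracial states\<close>

abbreviation commutator_sum :: "'a::cstar_algebra list \<Rightarrow> 'a" where
  "commutator_sum xs \<equiv> (\<Sum>x\<leftarrow>xs. star x * x - x * star x)"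

text \<open>The entries occur quadratically, hence the square root. Together with concatenation of
  lists for sums, this makes the commutator sums a convex cone.\<close>

lemma commutator_sum_scale:
  "0 \<le> r \<Longrightarrow> commutator_sum (map (scaleR (sqrt r)) xs) = r *\<^sub>R commutator_sum xs"
  by (induction xs) (simp_all add: algebra_simps)

text \<open>This is the usual recovery of a complex functional from its real part \<open>f\<close>.
  Invariance under \<open>star\<close> makes \<open>f\<close> vanish on \<open>scaleC \<i> a\<close>
  for selfadjoint \<open>a\<close>, so the functional is real on \<open>star x * x\<close>.\<close>

lemma tracial_state_from_functional:
  fixes f :: "'a::cstar_algebra \<Rightarrow> real"
  assumes "linear f" and one: "f 1 = 1" and star: "\<And>x. f (star x) = f x"
    and nonneg: "\<And>x. 0 \<le> f (star x * x)" and tr: "\<And>x. f (star x * x) = f (x * star x)"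
  shows "(\<lambda>x. complex_of_real (f x) - \<i> * complex_of_real (f (scaleC \<i> x))) \<in> tracial_states"
proof -
  interpret linear f by fact
  define \<tau> where "\<tau> x = complex_of_real (f x) - \<i> * complex_of_real (f (scaleC \<i> x))" for x
  have selfadj: "f (scaleC \<i> a) = 0" if "star a = a" for a
    using star[of "scaleC \<i> a"] that by (simp add: star_scaleC neg)
  \<comment> \<open>Polarization: expanding \<open>tr\<close> at \<open>star x + y\<close> leaves
    \<open>f\<close> of \<open>x * y\<close> and of its adjoint on one side, and the same for
    \<open>y * x\<close> on the other.\<close>
  have comm: "f (x * y) = f (y * x)" for x y
    using tr[of "star x + y"] tr[of "star x"] tr[of y] star[of "x * y"] star[of "y * x"]
    by (simp add: star_add star_mult distrib_left distrib_right add)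
  have "\<tau> (x + y) = \<tau> x + \<tau> y" for x y
    by (simp add: \<tau>_def add scaleC_add_right algebra_simps)
  moreover have "\<tau> (scaleC c x) = c * \<tau> x" for c x
  proof -
    have "f (scaleC c x) = Re c * f x + Im c * f (scaleC \<i> x)"
      by (subst scaleC_complex) (simp add: add scaleR)
    moreover have "f (scaleC \<i> (scaleC c x)) = Re c * f (scaleC \<i> x) - Im c * f x"
      by (subst scaleC_complex[of c]) (simp add: add diff scaleR neg scaleC_add_right scaleC_diff_right scaleC_scaleR)
    ultimately show ?thesis by (simp add: \<tau>_def complex_eq_iff)
  qed
  moreover have "\<tau> (star x * x) \<in> \<real>\<^sub>\<ge>\<^sub>0" for x
    using nonneg[of x] selfadj[of "star x * x"] by (simp add: \<tau>_def star_mult)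
  moreover have "\<tau> 1 = 1"
    using selfadj[of 1] by (simp add: \<tau>_def one)
  moreover have "\<tau> (x * y) = \<tau> (y * x)" for x y
    using comm[of x y] comm[of "scaleC \<i> x" y]
    by (simp add: \<tau>_def mult_scaleC_left mult_scaleC_right)
  ultimately have "\<tau> \<in> tracial_states" by (simp add: tracial_states_def)
  then show ?thesis by (simp add: \<tau>_def[abs_def])
qed

lemma no_tracial_state_commutator_sum:
  assumes "(tracial_states :: ('a::cstar_algebra \<Rightarrow> complex) set) = {}"
  obtains q :: "'a::cstar_algebra" and xs where "q \<in> pos" "- 1 = q + commutator_sum xs"
proof -
  \<comment> \<open>Passing through \<open>x + star x\<close> makes \<open>K\<close> a cone in the
    whole algebra that contains each skew element and its negative; this forces
    \<open>f (star x) = f x\<close>. Selfadjoint elements enter doubled, which accounts for the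
    lists \<open>[x, x]\<close> and for the final factor \<open>1/2\<close>.\<close>
  define K where "K = {x::'a. \<exists>q\<in>pos. \<exists>xs. x + star x = q + commutator_sum xs}"
  have KI: "x \<in> K" if "q \<in> pos" "x + star x = q + commutator_sum xs" for x q xs
    using that unfolding K_def by blast
  have "- 1 \<in> K"
  proof (rule ccontr)
    assume "- 1 \<notin> K"
    have "0 \<in> K" by (rule KI[OF zero_in_pos, of _ "[]"]) simp
    moreover have "x + y \<in> K" if "x \<in> K" "y \<in> K" for x y
    proof -
      obtain p q xs ys where pq: "p \<in> pos" "q \<in> pos"
        and xy: "x + star x = p + commutator_sum xs" "y + star y = q + commutator_sum ys"
        using \<open>x \<in> K\<close> \<open>y \<in> K\<close> unfolding K_def by blast
      have "(x + y) + star (x + y) = (x + star x) + (y + star y)"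
        by (simp add: star_add)
      also have "\<dots> = (p + q) + commutator_sum (xs @ ys)"
        by (simp add: xy)
      finally show ?thesis by (rule KI[OF pos_add[OF pq]])
    qed
    moreover have "r *\<^sub>R x \<in> K" if r: "0 \<le> r" and "x \<in> K" for r x
    proof -
      obtain q xs where q: "q \<in> pos" and x: "x + star x = q + commutator_sum xs"
        using \<open>x \<in> K\<close> unfolding K_def by blast
      have "r *\<^sub>R x + star (r *\<^sub>R x) = r *\<^sub>R (x + star x)" by (simp add: scaleR_add_right)
      also have "\<dots> = r *\<^sub>R q + commutator_sum (map (scaleR (sqrt r)) xs)"
        by (simp only: x commutator_sum_scale[OF r] scaleR_add_right)
      finally show ?thesis by (rule KI[OF pos_scaleR[OF q r]])
    qed
    moreover have "\<exists>t. t *\<^sub>R 1 - x \<in> K" for x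
    proof (intro exI)
      let ?t = "norm (x + star x) / 2"
      have "of_real (norm (x + star x)) - (x + star x) \<in> pos"
        by (rule of_real_minus_in_pos) (simp_all add: star_add add.commute)
      then show "?t *\<^sub>R 1 - x \<in> K"
        by (rule KI[where xs = "[]"])
          (simp add: star_diff of_real_def algebra_simps flip: scaleR_add_left)
    qed
    ultimately obtain f :: "'a \<Rightarrow> real" where f: "linear f" "f 1 = 1" "\<And>x. x \<in> K \<Longrightarrow> 0 \<le> f x"
      using order_unit_functional[of K 1] \<open>- 1 \<notin> K\<close> by blast
    interpret linear f by fact
    have zero: "f x = 0" if "x \<in> K" "- x \<in> K" for x
      using f(3)[OF that(1)] f(3)[OF that(2)] by (simp add: neg)
    have "f (star x) = f x" for x
    proof -
      have "f (star x - x) = 0"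
        by (rule zero; rule KI[OF zero_in_pos, of _ "[]"]) (simp_all add: star_diff)
      then show ?thesis by (simp add: diff)
    qed
    moreover have "0 \<le> f (star x * x)" for x
    proof (intro f(3) KI[where xs = "[]"])
      show "star x * x + star x * x \<in> pos" by (intro pos_add star_mult_self_in_pos)
    qed (simp add: star_mult)
    moreover have "f (star x * x) = f (x * star x)" for x
    proof -
      have "star x * x - x * star x \<in> K"
        by (rule KI[OF zero_in_pos, of _ "[x, x]"]) (simp add: star_diff star_mult)
      moreover have "- (star x * x - x * star x) \<in> K"
        by (rule KI[OF zero_in_pos, of _ "[star x, star x]"]) (simp add: star_diff star_mult)
      ultimately have "f (star x * x - x * star x) = 0" by (rule zero)
      then show ?thesis by (simp add: diff)
    qed
    ultimately show False
      using tracial_state_from_functional[of f] f assms by blast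
  qed
  then obtain q :: 'a and xs where q: "q \<in> pos" and eq: "- 1 + star (- 1) = q + commutator_sum xs"
    unfolding K_def by blast
  have "(1/2) *\<^sub>R (q + commutator_sum xs) = - 1"
    unfolding eq[symmetric] by (simp flip: scaleR_2)
  then have "- 1 = (1/2) *\<^sub>R q + commutator_sum (map (scaleR (sqrt (1/2))) xs)"
    by (simp only: commutator_sum_scale[of "1/2"] scaleR_add_right)
  then show thesis using that q by (meson pos_scaleR zero_le_divide_1_iff zero_le_numeral)
qed

text \<open>Pop's argument: modulo commutators, a selfadjoint element does not change under the completely
  positive map \<open>\<Phi>\<close>, which is a strict contraction on selfadjoint elements because \<open>\<Phi> 1 \<le> 1 - s\<close>.\<close>

lemma selfadjoint_in_closed_commutator_space:
  fixes V :: "'a::cstar_algebra set"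
  assumes no_trace: "(tracial_states :: ('a \<Rightarrow> complex) set) = {}"
    and "closed V" and V0: "subspace V" and comm: "\<And>x. star x * x - x * star x \<in> V"
    and a: "star a = a"
  shows "a \<in> V"
proof -
  obtain q :: 'a and xs where q: "q \<in> pos" and eq: "- 1 = q + commutator_sum xs"
    using no_tracial_state_commutator_sum[OF no_trace] .
  define R S where "R = (\<Sum>x\<leftarrow>xs. star x * x)" and "S = (\<Sum>x\<leftarrow>xs. x * star x)"
  \<comment> \<open>The surplus \<open>S - R = 1 + q\<close> is at least \<open>1\<close>; it is the
    source of the contraction.\<close>
  have RS: "R + q + 1 = S"
  proof -
    have "commutator_sum xs = R - S" by (simp add: R_def S_def sum_list_subtractf)
    with eq have "- 1 = q + (R - S)" by simp
    then show ?thesis by (simp add: algebra_simps)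
  qed
  \<comment> \<open>The \<open>+ 1\<close> makes \<open>s * norm S < 1\<close> strict, so that
    \<open>1 - s *\<^sub>R S\<close> has a root \<open>b\<close>.\<close>
  define s where "s = 1 / (norm S + 1)"
  have s: "0 < s" "s \<le> 1" "s * norm S < 1"
    by (simp_all add: s_def divide_simps add_nonneg_pos)
  have sS: "star S = S"
    unfolding S_def by (induction xs) (simp_all add: star_add star_mult)
  obtain b where b: "star b = b" "b * b = 1 - s *\<^sub>R S"
    using sqrt_one_minus[of "s *\<^sub>R S"] s sS by (metis abs_of_pos norm_scaleR star_scaleR)
  define \<Psi> where "\<Psi> a = (\<Sum>x\<leftarrow>xs. star x * a * x)" for a
  \<comment> \<open>\<open>b\<close> completes the sum: \<open>s *\<^sub>R S + b * b = 1\<close>.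
    Hence exchanging \<open>(c * x) * star (c * x)\<close> for \<open>star (c * x) * (c * x)\<close>
    term by term, and likewise with \<open>b\<close> for \<open>x\<close>, carries
    \<open>c * c\<close> to \<open>\<Phi> (c * c)\<close>.\<close>
  define \<Phi> where "\<Phi> a = s *\<^sub>R \<Psi> a + b * a * b" for a
  have "linear \<Psi>"
  proof (rule linearI)
    show "\<Psi> (a + b) = \<Psi> a + \<Psi> b" for a b
      by (simp add: \<Psi>_def distrib_left distrib_right sum_list_addf)
    show "\<Psi> (r *\<^sub>R a) = r *\<^sub>R \<Psi> a" for r a
      unfolding \<Psi>_def by (induction xs) (simp_all add: scaleR_add_right)
  qed
  interpret \<Psi>: linear \<Psi> by fact
  have "linear \<Phi>"
    by (rule linearI) (simp_all add: \<Phi>_def \<Psi>.add \<Psi>.scaleR algebra_simps)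
  interpret \<Phi>: linear \<Phi> by fact
  have "linear (\<lambda>a. a - \<Phi> a)"
    by (rule linearI) (simp_all add: \<Phi>.add \<Phi>.scaleR algebra_simps)
  interpret g: linear "\<lambda>a. a - \<Phi> a" by fact
  have \<Phi>pos: "\<Phi> a \<in> pos" if "a \<in> pos" for a
  proof -
    have "\<Psi> a \<in> pos" unfolding \<Psi>_def
      by (induction xs) (auto simp: zero_in_pos that intro!: pos_add conjugate_in_pos)
    then show ?thesis
      unfolding \<Phi>_def using s conjugate_in_pos[OF that, of b] b by (intro pos_add pos_scaleR) auto
  qed
  have \<Phi>star: "star (\<Phi> a) = \<Phi> a" if "star a = a" for a
  proof -
    have "star (\<Psi> a) = \<Psi> a" unfolding \<Psi>_def
      by (induction xs) (simp_all add: star_add star_mult that mult.assoc)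
    then show ?thesis by (simp add: \<Phi>_def star_add star_mult that b(1) mult.assoc)
  qed
  \<comment> \<open>\<open>\<Phi> 1 = s *\<^sub>R R + 1 - s *\<^sub>R S\<close>, and the surplus
    \<open>S - R = 1 + q\<close> leaves \<open>(1 - s) *\<^sub>R 1 - s *\<^sub>R q\<close>.\<close>
  have \<Phi>1: "\<Phi> 1 + s *\<^sub>R q = (1 - s) *\<^sub>R 1"
  proof -
    have "\<Phi> 1 + s *\<^sub>R q = s *\<^sub>R (R + q + 1 - S) + (1 - s) *\<^sub>R 1"
      by (simp add: \<Phi>_def \<Psi>_def R_def b(2) algebra_simps)
    then show ?thesis unfolding RS by simp
  qed
  have upper: "of_real ((1 - s) * norm a) - \<Phi> a \<in> pos" if "star a = a" for a
  proof -
    \<comment> \<open>The positive map is applied to \<open>of_real (norm a) - a\<close>, and the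
      multiple of \<open>q\<close> lost in \<open>\<Phi> 1\<close> is added back.\<close>
    have "\<Phi> (of_real (norm a) - a) + (norm a * s) *\<^sub>R q \<in> pos"
      using that s q by (intro pos_add \<Phi>pos of_real_minus_in_pos pos_scaleR) auto
    also have "\<Phi> (of_real (norm a) - a) + (norm a * s) *\<^sub>R q = norm a *\<^sub>R (\<Phi> 1 + s *\<^sub>R q) - \<Phi> a"
      by (simp add: \<Phi>.diff of_real_def \<Phi>.scaleR scaleR_add_right)
    finally show ?thesis unfolding \<Phi>1 by (simp add: of_real_def mult.commute)
  qed
  have contract: "norm (\<Phi> a) \<le> (1 - s) * norm a" if "star a = a" for a
  proof (rule norm_le_of_pos)
    show "of_real ((1 - s) * norm a) + \<Phi> a \<in> pos"
      using upper[of "- a"] that by (simp add: \<Phi>.neg)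
  qed (use that s \<Phi>star upper in auto)
  have square: "c * c - \<Phi> (c * c) \<in> V" if c: "star c = c" for c
  proof -
    have comm': "x * star x - star x * x \<in> V" for x
      using comm[of "star x"] by simp
    have "c * S * c - \<Psi> (c * c) \<in> V"
      unfolding S_def \<Psi>_def
    proof (induction xs)
      case (Cons x xs)
      have "(c * x) * star (c * x) - star (c * x) * (c * x)
          + (c * (\<Sum>x\<leftarrow>xs. x * star x) * c - (\<Sum>x\<leftarrow>xs. star x * (c * c) * x)) \<in> V"
        by (intro subspace_add[OF V0] comm' Cons)
      then show ?case by (simp add: c star_mult algebra_simps)
    qed (simp add: subspace_0[OF V0])
    then have "s *\<^sub>R (c * S * c - \<Psi> (c * c))
        + ((c * b) * star (c * b) - star (c * b) * (c * b)) \<in> V"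
      by (intro subspace_add[OF V0] subspace_scale[OF V0] comm')
    also have "s *\<^sub>R (c * S * c - \<Psi> (c * c)) + ((c * b) * star (c * b) - star (c * b) * (c * b))
        = c * (s *\<^sub>R S + b * b) * c - \<Phi> (c * c)"
      by (simp add: \<Phi>_def c b(1) star_mult algebra_simps)
    finally show ?thesis by (simp add: b(2))
  qed
  have step: "a - \<Phi> a \<in> V" if sa: "star a = a" for a
  proof -
    \<comment> \<open>This writes a selfadjoint element as a real combination of the squares of
      \<open>1\<close> and \<open>c\<close>; the extra summand \<open>1\<close> guarantees that the
      root \<open>c\<close> exists.\<close>
    obtain c where c: "star c = c" "c * c = (of_real (norm a) - a) + of_real 1"
      using pos_eps_square[OF of_real_minus_in_pos[OF sa order_refl] zero_less_one] by metis
    have "a = (norm a + 1) *\<^sub>R (1 * 1) - c * c"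
      unfolding c(2) by (simp add: of_real_def scaleR_add_left)
    then have "a - \<Phi> a = (norm a + 1) *\<^sub>R (1 * 1 - \<Phi> (1 * 1)) - (c * c - \<Phi> (c * c))"
      by (metis g.diff g.scaleR)
    then show ?thesis
      using square[OF c(1)] square[of 1]
      by (simp add: subspace_diff[OF V0] subspace_scale[OF V0])
  qed
  have sa: "star ((\<Phi> ^^ n) a) = (\<Phi> ^^ n) a" for n
    by (induction n) (simp_all add: a \<Phi>star)
  have "a - (\<Phi> ^^ n) a \<in> V" for n
  proof (induction n)
    case (Suc n)
    have "(a - (\<Phi> ^^ n) a) + ((\<Phi> ^^ n) a - \<Phi> ((\<Phi> ^^ n) a)) \<in> V"
      by (intro subspace_add[OF V0] Suc step sa)
    then show ?case by simp
  qed (simp add: subspace_0[OF V0])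
  moreover have "(\<lambda>n. a - (\<Phi> ^^ n) a) \<longlonglongrightarrow> a"
  proof -
    have "norm ((\<Phi> ^^ n) a) \<le> (1 - s) ^ n * norm a" for n
    proof (induction n)
      case (Suc n)
      have "norm (\<Phi> ((\<Phi> ^^ n) a)) \<le> (1 - s) * ((1 - s) ^ n * norm a)"
        using contract[OF sa[of n]] Suc s by (meson diff_ge_0_iff_ge mult_left_mono order_trans)
      then show ?case by (simp add: mult.assoc)
    qed simp
    moreover have "(\<lambda>n. (1 - s) ^ n * norm a) \<longlonglongrightarrow> 0"
      using s by (intro tendsto_mult_left_zero LIMSEQ_power_zero) auto
    ultimately have "(\<lambda>n. (\<Phi> ^^ n) a) \<longlonglongrightarrow> 0"
      by (intro Lim_null_comparison[of "\<lambda>n. (\<Phi> ^^ n) a"]) (auto intro: always_eventually)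
    from tendsto_diff[OF tendsto_const[of a] this] show ?thesis by simp
  qed
  ultimately show ?thesis
    using closed_sequentially[OF \<open>closed V\<close>, of "\<lambda>n. a - (\<Phi> ^^ n) a" a] by blast
qed

section \<open>From selfadjoint elements back to the unitary group\<close>

theorem U0_eq_CU:
  assumes "(tracial_states :: ('a::cstar_algebra \<Rightarrow> complex) set) = {}"
  shows "(U0 :: 'a set) = CU"
proof (rule antisym[OF U0_subset_CU CU_subset_U0])
  fix x :: 'a assume x: "star x = - x"
  \<comment> \<open>Multiplication by \<open>\<i>\<close> exchanges selfadjoint and skew elements;
    \<open>V\<close> is \<open>lieCU\<close> seen on the selfadjoint side.\<close>
  define V where "V = {a::'a. scaleC \<i> a \<in> lieCU}"
  have lie0: "0 \<in> (lieCU :: 'a set)" by (simp add: lieCU_def one_in_CU)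
  have "scaleC \<i> x \<in> V"
  proof (rule selfadjoint_in_closed_commutator_space[OF assms])
    have "bounded_linear (scaleC \<i> :: 'a \<Rightarrow> 'a)"
      by (rule bounded_linear_intro[where K = 1]) (simp_all add: scaleC_add_right scaleC_scaleR norm_scaleC)
    then have "continuous_on UNIV (scaleC \<i> :: 'a \<Rightarrow> 'a)"
      by (rule bounded_linear.continuous_on) simp
    then show "closed V"
      using closed_vimage[OF closed_lieCU] by (simp add: V_def vimage_def)
    show "subspace V"
      by (rule subspaceI) (simp_all add: V_def lie0 lieCU_add lieCU_scaleR scaleC_add_right scaleC_scaleR)
    show "star y * y - y * star y \<in> V" for y
    proof -
      \<comment> \<open>\<open>p\<close> and \<open>r\<close> are skew, and the commutator of
        \<open>y + star y\<close> with \<open>y - star y\<close> is twice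
        \<open>star y * y - y * star y\<close>, whence the factor \<open>1/2\<close>.\<close>
      define p where "p = y - star y"
      define r where "r = scaleC \<i> (y + star y)"
      have "(1/2) *\<^sub>R (r * p - p * r) \<in> lieCU"
        by (intro lieCU_scaleR commutator_in_lieCU)
          (simp_all add: p_def r_def star_diff star_add star_scaleC scaleC_add_right)
      moreover have "(1/2) *\<^sub>R (r * p - p * r) = scaleC \<i> (star y * y - y * star y)"
      proof -
        have "r * p - p * r = scaleC \<i> (2 *\<^sub>R (star y * y - y * star y))"
          unfolding r_def p_def mult_scaleC_left mult_scaleC_right scaleC_diff_right[symmetric]
          by (rule arg_cong[where f = "scaleC \<i>"]) (simp add: algebra_simps scaleR_2)
        then show ?thesis by (simp add: scaleC_scaleR)
      qed
      ultimately show ?thesis by (simp add: V_def)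
    qed
    show "star (scaleC \<i> x) = scaleC \<i> x"
      by (simp add: star_scaleC x)
  qed
  then have "- x \<in> lieCU" by (simp add: V_def)
  from exp_in_CU[OF this, of "- 1"] show "exp x \<in> CU" by simp
qed

text \<open>The embedding of \<open>a\<close> as the diagonal matrix \<open>mat a\<close> is a
  unital star homomorphism, so tracial states pull back along it. Used in the contrapositive:
  matrices have no tracial state when the algebra has none.\<close>

lemma tracial_state_of_matrices:
  fixes \<tau> :: "('a::cstar_algebra, 'n::finite) cmat \<Rightarrow> complex"
  assumes "\<tau> \<in> tracial_states"
  shows "(\<lambda>a. \<tau> (CMat (mat a))) \<in> tracial_states"
proof -
  define D :: "'a \<Rightarrow> ('a, 'n) cmat" where "D a = CMat (mat a)" for a
  have D: "entries (D a) $ i $ j = (if i = j then a else 0)" for a i j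
    by (simp add: D_def CMat_inverse mat_def)
  have "D (a + b) = D a + D b" "D (scaleC c a) = scaleC c (D a)" "D (star a) = star (D a)" "D 1 = 1"
    for a b c
    by (auto simp: cmat_eq_iff D plus_cmat.rep_eq scaleC_cmat.rep_eq star_cmat.rep_eq
        one_cmat.rep_eq mat_def)
  note hom = this
  have mult: "D (a * b) = D a * D b" for a b
    unfolding cmat_eq_iff
  proof (intro allI)
    fix i j
    have "(\<Sum>k\<in>UNIV. entries (D a) $ i $ k * entries (D b) $ k $ j)
        = (\<Sum>k\<in>UNIV. if i = k then a * (if k = j then b else 0) else 0)"
      by (rule sum.cong) (auto simp: D)
    then show "entries (D (a * b)) $ i $ j = entries (D a * D b) $ i $ j"
      by (simp add: D times_cmat.rep_eq matrix_matrix_mult_def)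
  qed
  show ?thesis
    using assms unfolding tracial_states_def D_def[symmetric] hom mult mem_Collect_eq by blast
qed

theorem corollary2p7:
  assumes "(tracial_states :: ('a::cstar_algebra \<Rightarrow> complex) set) = {}"
  shows "(U0 :: ('a, 'n::finite) cmat set) = CU"
proof (rule U0_eq_CU)
  show "(tracial_states :: (('a, 'n) cmat \<Rightarrow> complex) set) = {}"
    using assms tracial_state_of_matrices by blast
qed

end
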